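(* Let $l\in\{\mathbf{K},\mathbf{K4},\mathbf{D4},\mathbf{S4}\}$ and let $\varphi$ be a modal formula. The CC Procedure for $l$ on input $\varphi$ accepts $\varphi$ (that is, some sequence of its non-deterministic choices returns "accept") if and only if $\varphi$ is incomplete for $l$.
   Context: Modal formulas: $\varphi ::= \bot \mid \top \mid p \mid \neg p \mid \varphi\wedge\varphi \mid \varphi\vee\varphi \mid \Box\varphi \mid \Diamond\varphi$, with $p$ from a countably infinite set of propositional variables; negation of arbitrary formulas is defined by duality (negations pushed to literals), and $\rightarrow$ as usual. $P(\varphi)$ is the set of variables appearing in $\varphi$; $L(P)$ is the set of formulas with variables from $P$; $sub(\varphi)$ is the set of subformulas; $\overline{sub}(\varphi)=sub(\varphi)\cup\{\neg\psi\mid\psi\in sub(\varphi)\}$; $|\varphi|=|sub(\varphi)|$; $md(\psi)$ is the modal depth (nesting depth of modal operators); $\overline{sub}_d(\varphi)=\{\psi\in\overline{sub}(\varphi)\mid md(\psi)\le d\}$. $\mathbf{K}$ is the smallest normal modal logic; axioms $D:\Diamond\top$, $T:\Box\varphi\rightarrow\varphi$, $4:\Box\varphi\rightarrow\Box\Box\varphi$; $\mathbf{K4}=\mathbf{K}+4$, $\mathbf{D4}=\mathbf{K}+D+4$, $\mathbf{S4}=\mathbf{K}+T+4$ ($\mathbf{S4}$ also proves $D$). $\vdash_l$ is derivability in $l$ (equivalently validity in all finite models for $l$: serial for $D$, reflexive for $T$, transitive for $4$). A finite set of formulas is consistent if the negation of its conjunction is not derivable in $l$. A formula $\varphi$ is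 complete for $l$ if for every $\psi\in L(P(\varphi))$, $\vdash_l\varphi\rightarrow\psi$ or $\vdash_l\varphi\rightarrow\neg\psi$; otherwise it is incomplete. Fix $\varphi$ and let $P=P(\varphi)$. A state is a subset of $\overline{sub}(\varphi)$. For a state $a$, $th(a)=\bigwedge a$ (with $\bigwedge\emptyset=\top$) and $md(a)$ is the largest modal depth of its elements. A view $S$ is a pair $(p(S),C(S))$ of a state $p(S)$ (the parent-state) and a possibly empty set $C(S)$ of at most $|\varphi|$ states (the children-states). A set $s$ of formulas is $l$-closed if: $\varphi_1\wedge\varphi_2\in s$ implies $\varphi_1,\varphi_2\in s$; $\varphi_1\vee\varphi_2\in s$ implies $\varphi_1\in s$ or $\varphi_2\in s$; if $l$ has axiom $T$, $\Box\psi\in s$ implies $\psi\in s$; for every $p\in P$, either $p\in s$ or $\neg p\in s$. A view $S$ is $l$-complete if: $p(S)$ and every child-state are $l$-closed; for every $\Diamond\psi\in p(S)$, $\psi\in\bigcup C(S)$; for every $\Box\psi\in p(S)$, $\psi$ belongs to every child-state; if $l$ has axiom $4$, for every $\Box\psi\in p(S)$, $\Box\psi$ belongs to every child-state; if $l$ has $D$ (i.e. $l\in\{\mathbf{D4},\mathbf{S4}\}$), $C(S)\ne\emptyset$. A state is maximal if it is a maximally consistent subset of $\overline{sub}(\varphi)$. A child-state $c$ of $S$ is $\mathbf{K}$-maximal if it is a maximally consistent subset of $\overline{sub}_d(\varphi)$, where $d=\max\{md(c')\mid c'\in C(S)\}$. A view is consistent if each of its states is consistent. A view $S'$ completes a view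 $S$ if: $S'$ is $l$-complete; $p(S)\subseteq p(S')$; for every $a\in C(S)$ there is $a'\in C(S')$ with $a\subseteq a'$; and every $a'\in C(S')$ is $\mathbf{K}$-maximal if $l=\mathbf{K}$, and maximal if $l$ has axiom $4$. CC Procedure for $l$ on $\varphi$ (non-deterministic). Initial conditions: non-deterministically generate maximal states $a$ and $b$ that include $\varphi$; if there are none, return "reject". If $a\neq b$, return "accept". Initialize $N:=|\varphi|+2$. Construction: non-deterministically generate a consistent view $S$ that completes $(a,\emptyset)$, having up to $|\varphi|$ children-states. Condition: if $C(S)=\emptyset$, return "reject". If there is a child-state $c\in C(S)$ with $\not\vdash_l th(a)\rightarrow\Diamond th(c)$, return "accept". Next: otherwise, non-deterministically pick $c\in C(S)$ and set $a:=c$. If $N>0$, set $N:=N-1$ and continue from "Construction". If $N=0$, return "reject". *)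

theory Defs
  imports Main
begin

datatype fm =
    Falsum
  | Verum
  | Pos nat
  | Neg nat
  | And fm fm
  | Or fm fm
  | Box fm
  | Dia fm

primrec neg :: "fm \<Rightarrow> fm" where
  "neg Falsum = Verum"
| "neg Verum = Falsum"
| "neg (Pos p) = Neg p"
| "neg (Neg p) = Pos p"
| "neg (And f g) = Or (neg f) (neg g)"
| "neg (Or f g) = And (neg f) (neg g)"
| "neg (Box f) = Dia (neg f)"
| "neg (Dia f) = Box (neg f)"

definition Imp :: "fm \<Rightarrow> fm \<Rightarrow> fm" where
  "Imp f g = Or (neg f) g"

primrec vars :: "fm \<Rightarrow> nat set" where
  "vars Falsum = {}"
| "vars Verum = {}"
| "vars (Pos p) = {p}"
| "vars (Neg p) = {p}"
| "vars (And f g) = vars f \<union> vars g"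
| "vars (Or f g) = vars f \<union> vars g"
| "vars (Box f) = vars f"
| "vars (Dia f) = vars f"

definition lang :: "nat set \<Rightarrow> fm set" where
  "lang P = {f. vars f \<subseteq> P}"

text \<open>Negative literals are atomic in the grammar, so \<^term>\<open>Neg p\<close> has itself as its only
  subformula.  This only affects \<open>fsize\<close>: \<open>sub_bar\<close> contains \<^term>\<open>Pos p\<close> in any case.\<close>

primrec sub :: "fm \<Rightarrow> fm set" where
  "sub Falsum = {Falsum}"
| "sub Verum = {Verum}"
| "sub (Pos p) = {Pos p}"
| "sub (Neg p) = {Neg p}"
| "sub (And f g) = insert (And f g) (sub f \<union> sub g)"
| "sub (Or f g) = insert (Or f g) (sub f \<union> sub g)"
| "sub (Box f) = insert (Box f) (sub f)"
| "sub (Dia f) = insert (Dia f) (sub f)"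

definition sub_bar :: "fm \<Rightarrow> fm set" where
  "sub_bar f = sub f \<union> neg ` sub f"

definition fsize :: "fm \<Rightarrow> nat" where
  "fsize f = card (sub f)"

primrec md :: "fm \<Rightarrow> nat" where
  "md Falsum = 0"
| "md Verum = 0"
| "md (Pos p) = 0"
| "md (Neg p) = 0"
| "md (And f g) = max (md f) (md g)"
| "md (Or f g) = max (md f) (md g)"
| "md (Box f) = Suc (md f)"
| "md (Dia f) = Suc (md f)"

definition sub_bar_upto :: "nat \<Rightarrow> fm \<Rightarrow> fm set" where
  "sub_bar_upto d f = {g \<in> sub_bar f. md g \<le> d}"

datatype logic = K | K4 | D4 | S4

definition has_T :: "logic \<Rightarrow> bool" where
  "has_T l \<longleftrightarrow> l = S4"

definition has_4 :: "logic \<Rightarrow> bool" where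
  "has_4 l \<longleftrightarrow> l \<in> {K4, D4, S4}"

text \<open>S4 counts as having D because it proves D; the Hilbert system below does not take D as an
  axiom of S4.\<close>

definition has_D :: "logic \<Rightarrow> bool" where
  "has_D l \<longleftrightarrow> l \<in> {D4, S4}"

text \<open>Propositional evaluation with variables and boxed formulas as atoms.  A diamond is the dual
  of a box, so its value is determined by the value of that box.\<close>

primrec peval :: "(fm \<Rightarrow> bool) \<Rightarrow> fm \<Rightarrow> bool" where
  "peval v Falsum \<longleftrightarrow> False"
| "peval v Verum \<longleftrightarrow> True"
| "peval v (Pos p) \<longleftrightarrow> v (Pos p)"
| "peval v (Neg p) \<longleftrightarrow> \<not> v (Pos p)"
| "peval v (And f g) \<longleftrightarrow> peval v f \<and> peval v g"
| "peval v (Or f g) \<longleftrightarrow> peval v f \<or> peval v g"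
| "peval v (Box f) \<longleftrightarrow> v (Box f)"
| "peval v (Dia f) \<longleftrightarrow> \<not> v (Box (neg f))"

definition tautology :: "fm \<Rightarrow> bool" where
  "tautology f \<longleftrightarrow> (\<forall>v. peval v f)"

text \<open>Axioms are given as schemas, so closure under uniform substitution is built in.\<close>

inductive derivable :: "logic \<Rightarrow> fm \<Rightarrow> bool" for l where
  Taut: "tautology f \<Longrightarrow> derivable l f"
| AxK: "derivable l (Imp (Box (Imp f g)) (Imp (Box f) (Box g)))"
| AxD: "l = D4 \<Longrightarrow> derivable l (Dia Verum)"
| AxT: "l = S4 \<Longrightarrow> derivable l (Imp (Box f) f)"
| Ax4: "l \<in> {K4, D4, S4} \<Longrightarrow> derivable l (Imp (Box f) (Box (Box f)))"
| MP: "derivable l (Imp f g) \<Longrightarrow> derivable l f \<Longrightarrow> derivable l g"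
| Nec: "derivable l f \<Longrightarrow> derivable l (Box f)"

definition complete :: "logic \<Rightarrow> fm \<Rightarrow> bool" where
  "complete l f \<longleftrightarrow>
     (\<forall>g \<in> lang (vars f). derivable l (Imp f g) \<or> derivable l (Imp f (neg g)))"

definition incomplete :: "logic \<Rightarrow> fm \<Rightarrow> bool" where
  "incomplete l f \<longleftrightarrow> \<not> complete l f"

fun conj_list :: "fm list \<Rightarrow> fm" where
  "conj_list [] = Verum"
| "conj_list [f] = f"
| "conj_list (f # g # fs) = And f (conj_list (g # fs))"

text \<open>The conjunction of a finite set in an arbitrary but fixed order; up to provable equivalence
  the order is irrelevant.  Only used on finite sets.\<close>

definition th :: "fm set \<Rightarrow> fm" where
  "th a = conj_list (SOME fs. set fs = a \<and> distinct fs)"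

definition consistent :: "logic \<Rightarrow> fm set \<Rightarrow> bool" where
  "consistent l a \<longleftrightarrow> \<not> derivable l (neg (th a))"

definition max_consistent_in :: "logic \<Rightarrow> fm set \<Rightarrow> fm set \<Rightarrow> bool" where
  "max_consistent_in l X a \<longleftrightarrow>
     a \<subseteq> X \<and> consistent l a \<and> (\<forall>b. a \<subset> b \<and> b \<subseteq> X \<longrightarrow> \<not> consistent l b)"

type_synonym state = "fm set"

definition is_state :: "fm \<Rightarrow> state \<Rightarrow> bool" where
  "is_state \<phi> a \<longleftrightarrow> a \<subseteq> sub_bar \<phi>"

text \<open>The inserted 0 makes the depth of the empty state 0.\<close>

definition md_state :: "state \<Rightarrow> nat" where
  "md_state a = Max (insert 0 (md ` a))"

datatype view = View (parent: state) (children: "state set")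

definition is_view :: "fm \<Rightarrow> view \<Rightarrow> bool" where
  "is_view \<phi> S \<longleftrightarrow> is_state \<phi> (parent S) \<and> (\<forall>c \<in> children S. is_state \<phi> c) \<and>
     card (children S) \<le> fsize \<phi>"

definition closed :: "logic \<Rightarrow> fm \<Rightarrow> fm set \<Rightarrow> bool" where
  "closed l \<phi> s \<longleftrightarrow>
     (\<forall>f g. And f g \<in> s \<longrightarrow> f \<in> s \<and> g \<in> s) \<and>
     (\<forall>f g. Or f g \<in> s \<longrightarrow> f \<in> s \<or> g \<in> s) \<and>
     (has_T l \<longrightarrow> (\<forall>f. Box f \<in> s \<longrightarrow> f \<in> s)) \<and>
     (\<forall>p \<in> vars \<phi>. Pos p \<in> s \<or> Neg p \<in> s)"

definition view_complete :: "logic \<Rightarrow> fm \<Rightarrow> view \<Rightarrow> bool" where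
  "view_complete l \<phi> S \<longleftrightarrow>
     closed l \<phi> (parent S) \<and> (\<forall>c \<in> children S. closed l \<phi> c) \<and>
     (\<forall>f. Dia f \<in> parent S \<longrightarrow> f \<in> \<Union> (children S)) \<and>
     (\<forall>f. Box f \<in> parent S \<longrightarrow> (\<forall>c \<in> children S. f \<in> c)) \<and>
     (has_4 l \<longrightarrow> (\<forall>f. Box f \<in> parent S \<longrightarrow> (\<forall>c \<in> children S. Box f \<in> c))) \<and>
     (has_D l \<longrightarrow> children S \<noteq> {})"

definition maximal :: "logic \<Rightarrow> fm \<Rightarrow> state \<Rightarrow> bool" where
  "maximal l \<phi> a \<longleftrightarrow> max_consistent_in l (sub_bar \<phi>) a"

definition K_maximal :: "fm \<Rightarrow> view \<Rightarrow> state \<Rightarrow> bool" where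
  "K_maximal \<phi> S c \<longleftrightarrow>
     max_consistent_in K (sub_bar_upto (Max (md_state ` children S)) \<phi>) c"

definition view_consistent :: "logic \<Rightarrow> view \<Rightarrow> bool" where
  "view_consistent l S \<longleftrightarrow> consistent l (parent S) \<and> (\<forall>c \<in> children S. consistent l c)"

definition completes :: "logic \<Rightarrow> fm \<Rightarrow> view \<Rightarrow> view \<Rightarrow> bool" where
  "completes l \<phi> S' S \<longleftrightarrow>
     view_complete l \<phi> S' \<and>
     parent S \<subseteq> parent S' \<and>
     (\<forall>a \<in> children S. \<exists>a' \<in> children S'. a \<subseteq> a') \<and>
     (\<forall>a' \<in> children S'. (l = K \<longrightarrow> K_maximal \<phi> S' a') \<and> (has_4 l \<longrightarrow> maximal l \<phi> a'))"

datatype outcome = Accept | Reject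

definition cc_construct :: "logic \<Rightarrow> fm \<Rightarrow> state \<Rightarrow> view \<Rightarrow> bool" where
  "cc_construct l \<phi> a S \<longleftrightarrow>
     is_view \<phi> S \<and> view_consistent l S \<and> completes l \<phi> S (View a {})"

definition cc_accept_cond :: "logic \<Rightarrow> state \<Rightarrow> view \<Rightarrow> bool" where
  "cc_accept_cond l a S \<longleftrightarrow> (\<exists>c \<in> children S. \<not> derivable l (Imp (th a) (Dia (th c))))"

text \<open>\<open>cc_loop l \<phi> a N r\<close>: some sequence of choices, started at the Construction step with
  current state \<open>a\<close> and counter \<open>N\<close>, returns \<open>r\<close>.\<close>

inductive cc_loop :: "logic \<Rightarrow> fm \<Rightarrow> state \<Rightarrow> nat \<Rightarrow> outcome \<Rightarrow> bool" for l \<phi> where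
  cond_reject:
    "cc_construct l \<phi> a S \<Longrightarrow> children S = {} \<Longrightarrow> cc_loop l \<phi> a N Reject"
| cond_accept:
    "cc_construct l \<phi> a S \<Longrightarrow> children S \<noteq> {} \<Longrightarrow> cc_accept_cond l a S \<Longrightarrow>
     cc_loop l \<phi> a N Accept"
| next_continue:
    "cc_construct l \<phi> a S \<Longrightarrow> children S \<noteq> {} \<Longrightarrow> \<not> cc_accept_cond l a S \<Longrightarrow>
     c \<in> children S \<Longrightarrow> N > 0 \<Longrightarrow> cc_loop l \<phi> c (N - 1) r \<Longrightarrow> cc_loop l \<phi> a N r"
| next_reject:
    "cc_construct l \<phi> a S \<Longrightarrow> children S \<noteq> {} \<Longrightarrow> \<not> cc_accept_cond l a S \<Longrightarrow>
     c \<in> children S \<Longrightarrow> N = 0 \<Longrightarrow> cc_loop l \<phi> a N Reject"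

inductive cc_run :: "logic \<Rightarrow> fm \<Rightarrow> outcome \<Rightarrow> bool" for l \<phi> where
  init_reject:
    "\<not> (\<exists>a. maximal l \<phi> a \<and> \<phi> \<in> a) \<Longrightarrow> cc_run l \<phi> Reject"
| init_accept:
    "maximal l \<phi> a \<Longrightarrow> \<phi> \<in> a \<Longrightarrow> maximal l \<phi> b \<Longrightarrow> \<phi> \<in> b \<Longrightarrow> a \<noteq> b \<Longrightarrow> cc_run l \<phi> Accept"
| init_loop:
    "maximal l \<phi> a \<Longrightarrow> \<phi> \<in> a \<Longrightarrow> maximal l \<phi> b \<Longrightarrow> \<phi> \<in> b \<Longrightarrow> a = b \<Longrightarrow>
     cc_loop l \<phi> a (fsize \<phi> + 2) r \<Longrightarrow> cc_run l \<phi> r"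

definition cc_accepts :: "logic \<Rightarrow> fm \<Rightarrow> bool" where
  "cc_accepts l \<phi> \<longleftrightarrow> cc_run l \<phi> Accept"

end

theory Submission
  imports Defs
begin

text \<open>By Kripke completeness derivability is truth at every point of a canonical model, and a
  maximal state is the set of formulas of \<open>sub_bar \<phi>\<close> true at some point, its type.

  If the procedure accepts in K, a new root above points for the children of a view satisfies the
  parent, so two points that satisfy one child but differ on \<open>g\<close> give two points that satisfy the
  parent but differ on \<open>Dia (And (th c) g)\<close>; maximality keeps the other children from satisfying
  \<open>th c\<close>. In the transitive logics the acceptance step yields a state \<open>c\<close> with two models that
  differ on \<open>Dia (th e)\<close>. All points of type \<open>c\<close> in a model of \<open>\<phi>\<close> can be replaced at once by
  either of the two models without changing the types of the remaining points, and
  \<open>Dia (And (th c) (Dia (th e)))\<close> tells the two results apart.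

  Conversely, two points of the same type that disagree on some formula lead to acceptance. In K one
  descends to successors: as long as the procedure cannot accept, the child is forced below both
  points, and the depth of the state decreases; at depth 0 a childless root shows that any child
  is accepted. In the transitive logics the relation ``may be a child'' is transitive, and if two
  constructions never suffice to accept, equality of types is a bisimulation.\<close>

section \<open>Formulas\<close>

lemma neg_neg [simp]: "neg (neg f) = f"
  by (induction f) auto

lemma md_neg [simp]: "md (neg f) = md f"
  by (induction f) auto

lemma vars_neg [simp]: "vars (neg f) = vars f"
  by (induction f) auto

lemma neg_eq_iff: "neg f = g \<longleftrightarrow> f = neg g"
  by auto

lemma peval_neg [simp]: "peval v (neg f) \<longleftrightarrow> \<not> peval v f"
  by (induction f) auto

lemma peval_Imp [simp]: "peval v (Imp f g) \<longleftrightarrow> (peval v f \<longrightarrow> peval v g)"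
  by (auto simp: Imp_def)

lemma finite_sub [simp]: "finite (sub f)"
  by (induction f) auto

lemma sub_refl [simp]: "f \<in> sub f"
  by (cases f) auto

lemma vars_sub: "g \<in> sub f \<Longrightarrow> vars g \<subseteq> vars f"
  by (induction f) auto

lemma md_sub: "g \<in> sub f \<Longrightarrow> md g \<le> md f"
  by (induction f) auto

lemma size_sub: "g \<in> sub f \<Longrightarrow> size g \<le> size f"
  by (induction f) auto

lemma vars_in_sub: "p \<in> vars f \<Longrightarrow> Pos p \<in> sub f \<or> Neg p \<in> sub f"
  by (induction f) auto

text \<open>A modal operator raises both sides by one, because by \<open>size_sub\<close> the new
  formula is not among the subformulas of its argument. The bound makes the counter suffice for the
  descent in K.\<close>

lemma md_less_fsize: "md f < fsize f"
  unfolding fsize_def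
proof (induction f)
  case (And f g)
  have "card (sub f) \<le> card (sub (And f g))" "card (sub g) \<le> card (sub (And f g))"
    by (auto intro!: card_mono)
  then show ?case using And by simp
next
  case (Or f g)
  have "card (sub f) \<le> card (sub (Or f g))" "card (sub g) \<le> card (sub (Or f g))"
    by (auto intro!: card_mono)
  then show ?case using Or by simp
next
  case (Box f)
  have "Box f \<notin> sub f" using size_sub[of "Box f" f] by auto
  then show ?case using Box by simp
next
  case (Dia f)
  have "Dia f \<notin> sub f" using size_sub[of "Dia f" f] by auto
  then show ?case using Dia by simp
qed auto

lemma neg_sub_bar: "f \<in> sub_bar \<phi> \<Longrightarrow> neg f \<in> sub_bar \<phi>"
  by (auto simp: sub_bar_def)

lemma sub_bar_iff: "f \<in> sub_bar \<phi> \<longleftrightarrow> f \<in> sub \<phi> \<or> neg f \<in> sub \<phi>"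
  by (auto simp: sub_bar_def) (metis image_eqI neg_neg)

lemma finite_sub_bar [simp]: "finite (sub_bar \<phi>)"
  by (simp add: sub_bar_def)

lemma sub_arguments:
  "And f g \<in> sub \<phi> \<Longrightarrow> f \<in> sub \<phi> \<and> g \<in> sub \<phi>"
  "Or f g \<in> sub \<phi> \<Longrightarrow> f \<in> sub \<phi> \<and> g \<in> sub \<phi>"
  "Box f \<in> sub \<phi> \<Longrightarrow> f \<in> sub \<phi>"
  "Dia f \<in> sub \<phi> \<Longrightarrow> f \<in> sub \<phi>"
  by (induction \<phi>) auto

lemma sub_bar_And: "And f g \<in> sub_bar \<phi> \<Longrightarrow> f \<in> sub_bar \<phi> \<and> g \<in> sub_bar \<phi>"
  unfolding sub_bar_iff by (auto dest: sub_arguments)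

lemma sub_bar_Or: "Or f g \<in> sub_bar \<phi> \<Longrightarrow> f \<in> sub_bar \<phi> \<and> g \<in> sub_bar \<phi>"
  unfolding sub_bar_iff by (auto dest: sub_arguments)

lemma sub_bar_Box: "Box f \<in> sub_bar \<phi> \<Longrightarrow> f \<in> sub_bar \<phi>"
  unfolding sub_bar_iff by (auto dest: sub_arguments)

lemma sub_bar_Dia: "Dia f \<in> sub_bar \<phi> \<Longrightarrow> f \<in> sub_bar \<phi>"
  unfolding sub_bar_iff by (auto dest: sub_arguments)

lemma sub_bar_var: "p \<in> vars \<phi> \<Longrightarrow> Pos p \<in> sub_bar \<phi> \<and> Neg p \<in> sub_bar \<phi>"
  unfolding sub_bar_iff using vars_in_sub[of p \<phi>] by auto

lemma sub_bar_vars: "f \<in> sub_bar \<phi> \<Longrightarrow> vars f \<subseteq> vars \<phi>"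
  unfolding sub_bar_iff by (metis vars_sub vars_neg)

lemma sub_bar_md: "f \<in> sub_bar \<phi> \<Longrightarrow> md f \<le> md \<phi>"
  unfolding sub_bar_iff by (metis md_sub md_neg)

text \<open>Each \<open>Dia f\<close> in \<open>sub_bar \<phi>\<close> stems from
  \<open>Dia f\<close> or \<open>Box (neg f)\<close> in \<open>sub \<phi>\<close>, and a leaf of
  \<open>\<phi>\<close> is not modal. The strict bound leaves room for one extra child.\<close>

lemma card_Dia_sub_bar: "card {f. Dia f \<in> sub_bar \<phi>} < fsize \<phi>"
proof -
  let ?h = "\<lambda>f. if Dia f \<in> sub \<phi> then Dia f else Box (neg f)"
  let ?M = "{f \<in> sub \<phi>. \<exists>g. f = Dia g \<or> f = Box g}"
  have "inj ?h" by (auto simp: inj_def neg_eq_iff split: if_splits)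
  moreover have "?h ` {f. Dia f \<in> sub_bar \<phi>} \<subseteq> ?M"
    by (auto simp: sub_bar_iff)
  ultimately have "card {f. Dia f \<in> sub_bar \<phi>} \<le> card ?M"
    by (intro card_inj_on_le[of ?h]) (auto intro: inj_on_subset)
  moreover have "\<exists>f \<in> sub \<phi>. \<nexists>g. f = Dia g \<or> f = Box g"
    by (induction \<phi>) auto
  then have "?M \<subset> sub \<phi>" by blast
  then have "card ?M < card (sub \<phi>)" by (intro psubset_card_mono) auto
  ultimately show ?thesis by (simp add: fsize_def)
qed

section \<open>Kripke semantics\<close>

primrec sat :: "('w \<Rightarrow> 'w \<Rightarrow> bool) \<Rightarrow> ('w \<Rightarrow> nat \<Rightarrow> bool) \<Rightarrow> 'w \<Rightarrow> fm \<Rightarrow> bool" where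
  "sat R V w Falsum \<longleftrightarrow> False"
| "sat R V w Verum \<longleftrightarrow> True"
| "sat R V w (Pos p) \<longleftrightarrow> V w p"
| "sat R V w (Neg p) \<longleftrightarrow> \<not> V w p"
| "sat R V w (And f g) \<longleftrightarrow> sat R V w f \<and> sat R V w g"
| "sat R V w (Or f g) \<longleftrightarrow> sat R V w f \<or> sat R V w g"
| "sat R V w (Box f) \<longleftrightarrow> (\<forall>v. R w v \<longrightarrow> sat R V v f)"
| "sat R V w (Dia f) \<longleftrightarrow> (\<exists>v. R w v \<and> sat R V v f)"

lemma sat_neg [simp]: "sat R V w (neg f) \<longleftrightarrow> \<not> sat R V w f"
  by (induction f arbitrary: w) auto

lemma sat_Dia_dual: "sat R V w (Dia f) \<longleftrightarrow> \<not> sat R V w (Box (neg f))"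
  by simp

lemma sat_Imp [simp]: "sat R V w (Imp f g) \<longleftrightarrow> (sat R V w f \<longrightarrow> sat R V w g)"
  by (auto simp: Imp_def)

definition frame :: "logic \<Rightarrow> ('w \<Rightarrow> 'w \<Rightarrow> bool) \<Rightarrow> bool" where
  "frame l R \<longleftrightarrow> (has_T l \<longrightarrow> reflp R) \<and> (has_4 l \<longrightarrow> transp R) \<and> (has_D l \<longrightarrow> (\<forall>w. \<exists>v. R w v))"

lemma peval_sat: "peval (sat R V w) f \<longleftrightarrow> sat R V w f"
  by (induction f) auto

lemma soundness: "derivable l f \<Longrightarrow> frame l R \<Longrightarrow> sat R V w f"
proof (induction arbitrary: w rule: derivable.induct)
  case (Taut f)
  then show ?case by (simp add: tautology_def flip: peval_sat)
qed (auto simp: frame_def has_T_def has_4_def has_D_def dest: reflpD transpD)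

section \<open>The canonical model\<close>

text \<open>Derivability of \<open>imps fs g\<close> serves as derivability of \<open>g\<close> from
  the premises \<open>fs\<close>; the curried form lets \<open>MP\<close> discharge one premise at a
  time.\<close>

primrec imps :: "fm list \<Rightarrow> fm \<Rightarrow> fm" where
  "imps [] g = g"
| "imps (f # fs) g = Imp f (imps fs g)"

lemma peval_imps [simp]:
  "peval v (imps fs g) \<longleftrightarrow> ((\<forall>f \<in> set fs. peval v f) \<longrightarrow> peval v g)"
  by (induction fs) auto

lemma derivable_imps:
  "derivable l (imps fs g) \<Longrightarrow> (\<And>f. f \<in> set fs \<Longrightarrow> derivable l f) \<Longrightarrow> derivable l g"
proof (induction fs)
  case (Cons f fs)
  then have "derivable l (imps fs g)" using derivable.MP[of l f "imps fs g"] by simp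
  then show ?case using Cons by simp
qed simp

text \<open>Reduces propositional steps in the calculus to a check on valuations.\<close>

lemma derivable_taut_cons:
  assumes "\<And>f. f \<in> set fs \<Longrightarrow> derivable l f"
    and "\<And>v. (\<forall>f \<in> set fs. peval v f) \<Longrightarrow> peval v g"
  shows "derivable l g"
proof -
  have "tautology (imps fs g)" using assms(2) by (simp add: tautology_def)
  then show ?thesis using assms(1) derivable.Taut derivable_imps by blast
qed

section \<open>Maximal consistent sets\<close>

definition cset :: "logic \<Rightarrow> fm set \<Rightarrow> bool" where
  "cset l G \<longleftrightarrow> \<not> (\<exists>fs. set fs \<subseteq> G \<and> derivable l (imps fs Falsum))"

definition mcs :: "logic \<Rightarrow> fm set \<Rightarrow> bool" where
  "mcs l G \<longleftrightarrow> cset l G \<and> (\<forall>f. f \<in> G \<or> neg f \<in> G)"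

text \<open>By Zorn's lemma: a refutation uses finitely many premises, so unions of chains stay
  consistent.\<close>

lemma lindenbaum:
  assumes "cset l G"
  shows "\<exists>H. G \<subseteq> H \<and> mcs l H"
proof -
  let ?A = "{H. G \<subseteq> H \<and> cset l H}"
  have "\<exists>M\<in>?A. \<forall>X\<in>?A. M \<subseteq> X \<longrightarrow> X = M"
  proof (rule subset_Zorn_nonempty)
    show "?A \<noteq> {}" using assms by auto
    fix \<C> assume C: "\<C> \<noteq> {}" "subset.chain ?A \<C>"
    have "cset l (\<Union>\<C>)"
      unfolding cset_def
    proof (rule notI, elim exE conjE)
      fix fs assume fs: "set fs \<subseteq> \<Union>\<C>" "derivable l (imps fs Falsum)"
      obtain X where "X \<in> \<C>" "set fs \<subseteq> X"
        using finite_subset_Union_chain[OF _ fs(1) C(1) C(2)] by auto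
      then show False using C(2) fs(2) by (auto simp: subset_chain_def cset_def)
    qed
    then show "\<Union>\<C> \<in> ?A" using C by (simp add: subset_chain_def) blast
  qed
  then obtain H where H: "G \<subseteq> H" "cset l H"
    and max: "\<And>X. G \<subseteq> X \<Longrightarrow> cset l X \<Longrightarrow> H \<subseteq> X \<Longrightarrow> X = H" by auto
  have "f \<in> H \<or> neg f \<in> H" for f
  proof (rule ccontr)
    assume n: "\<not> (f \<in> H \<or> neg f \<in> H)"
    have inc: "\<exists>fs. set fs \<subseteq> insert g H \<and> derivable l (imps fs Falsum)" if "g \<notin> H" for g
      using max[of "insert g H"] H(1) that by (auto simp: cset_def)
    obtain fs where fs: "set fs \<subseteq> insert f H" "derivable l (imps fs Falsum)"
      using inc n by blast
    obtain gs where gs: "set gs \<subseteq> insert (neg f) H" "derivable l (imps gs Falsum)"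
      using inc n by blast
    \<comment> \<open>Under any valuation each refutation has a false premise. At most one of
      \<open>f\<close> and \<open>neg f\<close> is false, so a false premise survives the removal of
      both.\<close>
    let ?hs = "removeAll f fs @ removeAll (neg f) gs"
    have "derivable l (imps ?hs Falsum)"
    proof (rule derivable_taut_cons[of "[imps fs Falsum, imps gs Falsum]"])
      fix v assume "\<forall>h\<in>set [imps fs Falsum, imps gs Falsum]. peval v h"
      then obtain h h' where "h \<in> set fs" "\<not> peval v h" "h' \<in> set gs" "\<not> peval v h'"
        by auto
      then show "peval v (imps ?hs Falsum)"
        by (cases "h = f"; cases "h' = neg f") auto
    qed (use fs gs in auto)
    moreover have "set ?hs \<subseteq> H" using fs gs by auto
    ultimately show False using H(2) unfolding cset_def by blast
  qed
  then show ?thesis using H by (auto simp: mcs_def)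
qed

lemma mcs_derive:
  assumes "mcs l G" "set fs \<subseteq> G" "derivable l (imps fs g)"
  shows "g \<in> G"
proof (rule ccontr)
  assume "g \<notin> G"
  then have "set (neg g # fs) \<subseteq> G" using assms(1,2) by (auto simp: mcs_def)
  moreover have "derivable l (imps (neg g # fs) Falsum)"
    by (rule derivable_taut_cons[of "[imps fs g]"]) (use assms(3) in auto)
  ultimately show False using assms(1) unfolding mcs_def cset_def by blast
qed

lemma mcs_taut:
  assumes "mcs l G" "set fs \<subseteq> G" "\<And>v. (\<forall>f \<in> set fs. peval v f) \<Longrightarrow> peval v g"
  shows "g \<in> G"
  using assms(1,2)
proof (rule mcs_derive)
  show "derivable l (imps fs g)"
    by (rule derivable.Taut) (use assms(3) in \<open>simp add: tautology_def\<close>)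
qed

lemma mcs_theorem: "mcs l G \<Longrightarrow> derivable l f \<Longrightarrow> f \<in> G"
  using mcs_derive[of l G "[]" f] by simp

lemma mcs_mp: "mcs l G \<Longrightarrow> derivable l (Imp f g) \<Longrightarrow> f \<in> G \<Longrightarrow> g \<in> G"
  using mcs_derive[of l G "[f]" g] by simp

lemma mcs_neg:
  assumes "mcs l G"
  shows "neg f \<in> G \<longleftrightarrow> f \<notin> G"
proof -
  have "\<not> (f \<in> G \<and> neg f \<in> G)"
  proof
    assume "f \<in> G \<and> neg f \<in> G"
    then have "Falsum \<in> G" by (intro mcs_taut[OF assms, of "[f, neg f]"]) auto
    then have "set [Falsum] \<subseteq> G" by simp
    moreover have "derivable l (imps [Falsum] Falsum)"
      by (rule derivable.Taut) (simp add: tautology_def)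
    ultimately show False using assms unfolding mcs_def cset_def by blast
  qed
  then show ?thesis using assms by (auto simp: mcs_def)
qed

text \<open>Induction from the right end keeps the last premise next to the conclusion, where
  \<open>AxK\<close> distributes the box over it.\<close>

lemma box_imps: "derivable l (imps gs f) \<Longrightarrow> derivable l (imps (map Box gs) (Box f))"
proof (induction gs arbitrary: f rule: rev_induct)
  case Nil
  then show ?case by (auto intro: derivable.Nec)
next
  case (snoc g gs)
  have eq: "imps (hs @ [h]) k = imps hs (Imp h k)" for hs h k
    by (induction hs) auto
  have "derivable l (imps gs (Imp g f))" using snoc.prems by (simp only: eq)
  then have d: "derivable l (imps (map Box gs) (Box (Imp g f)))" by (rule snoc.IH)
  have "derivable l (imps (map Box gs) (Imp (Box g) (Box f)))"
  proof (rule derivable_taut_cons)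
    fix h assume "h \<in> set [imps (map Box gs) (Box (Imp g f)),
      Imp (Box (Imp g f)) (Imp (Box g) (Box f))]"
    then show "derivable l h" using d derivable.AxK by auto
  qed (auto)
  then show ?case by (simp add: eq)
qed

text \<open>If the unboxed formulas of \<open>G\<close> together with \<open>neg f\<close> were
  inconsistent, \<open>box_imps\<close> would put \<open>Box f\<close> into
  \<open>G\<close>.\<close>

lemma mcs_successor:
  assumes "mcs l G" "Box f \<notin> G"
  shows "\<exists>H. mcs l H \<and> {g. Box g \<in> G} \<subseteq> H \<and> f \<notin> H"
proof -
  have "cset l (insert (neg f) {g. Box g \<in> G})"
    unfolding cset_def
  proof (rule notI, elim exE conjE)
    fix fs assume fs: "set fs \<subseteq> insert (neg f) {g. Box g \<in> G}" "derivable l (imps fs Falsum)"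
    let ?gs = "removeAll (neg f) fs"
    have "derivable l (imps ?gs f)"
    proof (rule derivable_taut_cons[of "[imps fs Falsum]"])
      fix v assume "\<forall>h\<in>set [imps fs Falsum]. peval v h"
      then obtain h where "h \<in> set fs" "\<not> peval v h" by auto
      then show "peval v (imps ?gs f)" by (cases "h = neg f") auto
    qed (use fs in auto)
    then have "derivable l (imps (map Box ?gs) (Box f))" by (rule box_imps)
    moreover have "set (map Box ?gs) \<subseteq> G" using fs by auto
    ultimately show False using assms mcs_derive by blast
  qed
  then obtain H where "insert (neg f) {g. Box g \<in> G} \<subseteq> H" "mcs l H" using lindenbaum by blast
  then show ?thesis using mcs_neg by auto
qed

text \<open>Sets that are not maximal consistent are isolated reflexive points, so that the relation on
  the whole type is a frame for the logic and no carrier set is needed.\<close>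

definition cR :: "logic \<Rightarrow> fm set \<Rightarrow> fm set \<Rightarrow> bool" where
  "cR l G H \<longleftrightarrow> (if mcs l G \<and> mcs l H then \<forall>f. Box f \<in> G \<longrightarrow> f \<in> H else G = H)"

definition cV :: "fm set \<Rightarrow> nat \<Rightarrow> bool" where
  "cV G p \<longleftrightarrow> Pos p \<in> G"

abbreviation csat :: "logic \<Rightarrow> fm set \<Rightarrow> fm \<Rightarrow> bool" where
  "csat l \<equiv> sat (cR l) cV"

lemma mcs_Dia: "mcs l G \<Longrightarrow> Dia f \<in> G \<longleftrightarrow> Box (neg f) \<notin> G"
  using mcs_neg[of l G "Dia f"] by auto

lemma frame_cR: "frame l (cR l)"
  unfolding frame_def
proof (intro conjI impI)
  assume "has_T l"
  then have "Box f \<in> G \<longrightarrow> f \<in> G" if "mcs l G" for G f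
    using mcs_mp[OF that derivable.AxT] unfolding has_T_def by blast
  then show "reflp (cR l)" unfolding reflp_def cR_def by presburger
next
  assume "has_4 l"
  then have "Box f \<in> G \<longrightarrow> Box (Box f) \<in> G" if "mcs l G" for G f
    using mcs_mp[OF that derivable.Ax4] unfolding has_4_def by blast
  then show "transp (cR l)" unfolding transp_def cR_def by metis
next
  assume D: "has_D l"
  show "\<forall>G. \<exists>H. cR l G H"
  proof
    fix G
    show "\<exists>H. cR l G H"
    proof (cases "mcs l G")
      case False
      then show ?thesis by (auto simp: cR_def)
    next
      case m: True
      \<comment> \<open>S4 is serial through reflexivity, since \<open>AxD\<close> is an axiom of D4
        only.\<close>
      from D consider "l = S4" | "l = D4" by (auto simp: has_D_def)
      then show ?thesis
      proof cases
        case 1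
        then have "cR l G G" using m mcs_mp[OF m derivable.AxT] unfolding cR_def by auto
        then show ?thesis by blast
      next
        case 2
        then have "Dia Verum \<in> G" using m by (auto intro: mcs_theorem derivable.AxD)
        then have "Box Falsum \<notin> G" using m mcs_Dia by auto
        then obtain H where "mcs l H" "{g. Box g \<in> G} \<subseteq> H" using mcs_successor[OF m] by blast
        then have "cR l G H" using m by (auto simp: cR_def)
        then show ?thesis ..
      qed
    qed
  qed
qed

lemma trans_cR: "has_4 l \<Longrightarrow> cR l x y \<Longrightarrow> cR l y z \<Longrightarrow> cR l x z"
  using frame_cR[of l] unfolding frame_def by (meson transpD)

text \<open>Separate from the induction because the \<open>Dia\<close> case of \<open>truth\<close>
  applies it to \<open>neg f\<close>, for which the induction itself supplies no hypothesis.\<close>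

lemma truth_Box:
  assumes "mcs l G" and IH: "\<And>H. mcs l H \<Longrightarrow> csat l H f \<longleftrightarrow> f \<in> H"
  shows "csat l G (Box f) \<longleftrightarrow> Box f \<in> G"
proof
  assume L: "csat l G (Box f)"
  show "Box f \<in> G"
  proof (rule ccontr)
    assume "Box f \<notin> G"
    then obtain H where H: "mcs l H" "{g. Box g \<in> G} \<subseteq> H" "f \<notin> H"
      using mcs_successor[OF assms(1)] by blast
    then have "cR l G H" using assms(1) unfolding cR_def by auto
    then show False using L IH[OF H(1)] H(3) by simp
  qed
next
  assume R: "Box f \<in> G"
  have "csat l H f" if "cR l G H" for H
  proof -
    have "mcs l H" "f \<in> H" using that assms(1) R unfolding cR_def by (auto split: if_splits)
    then show ?thesis using IH by blast
  qed
  then show "csat l G (Box f)" by simp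
qed

lemma truth: "mcs l G \<Longrightarrow> csat l G f \<longleftrightarrow> f \<in> G"
proof (induction f arbitrary: G)
  case Falsum
  have "Verum \<in> G" by (rule mcs_taut[OF Falsum, of "[]"]) auto
  then show ?case using mcs_neg[OF Falsum, of Falsum] by simp
next
  case Verum
  have "Verum \<in> G" by (rule mcs_taut[OF Verum, of "[]"]) auto
  then show ?case by simp
next
  case (Pos p)
  then show ?case by (simp add: cV_def)
next
  case (Neg p)
  then show ?case using mcs_neg[of l G "Pos p"] by (simp add: cV_def)
next
  case (And f g)
  have "And f g \<in> G" if "f \<in> G" "g \<in> G"
    by (rule mcs_taut[OF And.prems, of "[f, g]"]) (use that in auto)
  moreover have "f \<in> G" "g \<in> G" if "And f g \<in> G"
    by (rule mcs_taut[OF And.prems, of "[And f g]"]; use that in simp)+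
  ultimately show ?case using And.IH[OF And.prems] by auto
next
  case (Or f g)
  have "g \<in> G" if "Or f g \<in> G" "neg f \<in> G"
    by (rule mcs_taut[OF Or.prems, of "[Or f g, neg f]"]) (use that in auto)
  moreover have "Or f g \<in> G" if "f \<in> G"
    by (rule mcs_taut[OF Or.prems, of "[f]"]) (use that in auto)
  moreover have "Or f g \<in> G" if "g \<in> G"
    by (rule mcs_taut[OF Or.prems, of "[g]"]) (use that in auto)
  ultimately show ?case using Or.IH[OF Or.prems] mcs_neg[OF Or.prems, of f] by auto
next
  case (Box f)
  then show ?case using truth_Box by blast
next
  case (Dia f)
  have "csat l G (Box (neg f)) \<longleftrightarrow> Box (neg f) \<in> G"
    using Dia.IH mcs_neg by (intro truth_Box[OF Dia.prems]) simp
  then show ?case unfolding sat_Dia_dual mcs_Dia[OF Dia.prems] by simp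
qed

lemma completeness:
  assumes "\<not> derivable l f"
  shows "\<exists>w. \<not> csat l w f"
proof -
  have "cset l {neg f}"
    unfolding cset_def
  proof (rule notI, elim exE conjE)
    fix fs assume fs: "set fs \<subseteq> {neg f}" "derivable l (imps fs Falsum)"
    have "derivable l f"
      by (rule derivable_taut_cons[of "[imps fs Falsum]"]) (use fs in auto)
    then show False using assms by simp
  qed
  from lindenbaum[OF this] obtain G where "neg f \<in> G" "mcs l G" by auto
  then have "\<not> csat l G f" by (simp add: truth mcs_neg)
  then show ?thesis ..
qed

lemma derivable_iff: "derivable l f \<longleftrightarrow> (\<forall>w. csat l w f)"
  using completeness[of l f] soundness[OF _ frame_cR, of l f] by auto

text \<open>The formulas true at one point form a maximal consistent set. Models built on other
  types can therefore be pulled back to points of the canonical model.\<close>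

lemma canonical_twin:
  assumes "frame l R"
  shows "\<exists>x. \<forall>f. csat l x f \<longleftrightarrow> sat R V w f"
proof -
  let ?G = "{f. sat R V w f}"
  have imps: "sat R V w (imps fs g) \<longleftrightarrow> ((\<forall>f\<in>set fs. sat R V w f) \<longrightarrow> sat R V w g)" for fs g
    by (induction fs) auto
  have "cset l ?G"
    unfolding cset_def
  proof (rule notI, elim exE conjE)
    fix fs assume "set fs \<subseteq> ?G" "derivable l (imps fs Falsum)"
    then show False using soundness[OF _ assms, of "imps fs Falsum" V w] by (auto simp: imps)
  qed
  then have "mcs l ?G" by (simp add: mcs_def)
  then have "csat l ?G f \<longleftrightarrow> sat R V w f" for f by (simp add: truth)
  then show ?thesis by blast
qed

section \<open>States as types of points\<close>

lemma finite_enum: "finite a \<Longrightarrow> set (SOME fs. set fs = a \<and> distinct fs) = a"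
  using someI_ex[OF finite_distinct_list] by blast

lemma sat_conj_list: "sat R V w (conj_list fs) \<longleftrightarrow> (\<forall>f\<in>set fs. sat R V w f)"
  by (induction fs rule: conj_list.induct) auto

lemma sat_th [simp]: "finite a \<Longrightarrow> sat R V w (th a) \<longleftrightarrow> (\<forall>f\<in>a. sat R V w f)"
  by (simp add: th_def sat_conj_list finite_enum)

lemma vars_conj_list: "vars (conj_list fs) \<subseteq> (\<Union>f\<in>set fs. vars f)"
  by (induction fs rule: conj_list.induct) auto

lemma vars_th:
  assumes "a \<subseteq> sub_bar \<phi>"
  shows "vars (th a) \<subseteq> vars \<phi>"
proof -
  have "finite a" using assms finite_sub_bar finite_subset by blast
  then have "vars (th a) \<subseteq> (\<Union>f\<in>a. vars f)"
    unfolding th_def using vars_conj_list[of "SOME fs. set fs = a \<and> distinct fs"]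
    by (simp add: finite_enum)
  then show ?thesis using assms sub_bar_vars by blast
qed

lemma consistent_iff: "finite a \<Longrightarrow> consistent l a \<longleftrightarrow> (\<exists>w. \<forall>f\<in>a. csat l w f)"
  by (auto simp: consistent_def derivable_iff)

definition ty :: "logic \<Rightarrow> fm set \<Rightarrow> fm set \<Rightarrow> fm set" where
  "ty l X w = {f \<in> X. csat l w f}"

lemma ty_eqD:
  assumes "ty l X v = ty l X w" "f \<in> X"
  shows "csat l v f \<longleftrightarrow> csat l w f"
proof -
  have "f \<in> ty l X v \<longleftrightarrow> f \<in> ty l X w" by (simp only: assms(1))
  then show ?thesis using assms(2) by (simp add: ty_def)
qed

text \<open>One inclusion is enough: a formula false at \<open>w\<close> contributes its negation to
  the type of \<open>w\<close>.\<close>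

lemma ty_eqI:
  assumes "\<And>f. f \<in> X \<Longrightarrow> neg f \<in> X" "\<forall>f\<in>ty l X w. csat l v f"
  shows "ty l X v = ty l X w"
proof -
  have "csat l v f \<longleftrightarrow> csat l w f" if f: "f \<in> X" for f
  proof (cases "csat l w f")
    case True
    then show ?thesis using f assms(2) by (simp add: ty_def)
  next
    case False
    then have "neg f \<in> ty l X w" using assms(1)[OF f] by (simp add: ty_def)
    then have "csat l v (neg f)" using assms(2) by blast
    then show ?thesis using False by simp
  qed
  then show ?thesis by (auto simp: ty_def)
qed

lemma finite_ty [simp]: "finite X \<Longrightarrow> finite (ty l X w)"
  by (simp add: ty_def)

lemma ty_consistent: "finite X \<Longrightarrow> consistent l (ty l X w)"
  by (subst consistent_iff) (auto simp: ty_def)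

text \<open>A consistent set holds at some point, whose type is a consistent superset; conversely
  \<open>ty_eqI\<close> leaves no room to enlarge a type.\<close>

lemma max_consistent_iff:
  assumes "finite X" "\<And>f. f \<in> X \<Longrightarrow> neg f \<in> X"
  shows "max_consistent_in l X a \<longleftrightarrow> (\<exists>w. a = ty l X w)"
proof
  assume a: "max_consistent_in l X a"
  then have X: "a \<subseteq> X" and "consistent l a" by (auto simp: max_consistent_in_def)
  then obtain w where w: "\<forall>f\<in>a. csat l w f"
    using consistent_iff[OF finite_subset[OF X assms(1)]] by blast
  then have "a \<subseteq> ty l X w" using X by (auto simp: ty_def)
  moreover have "\<not> a \<subset> ty l X w"
    using a ty_consistent[OF assms(1), of l w]
    unfolding max_consistent_in_def by (metis (no_types) Collect_subset ty_def)
  ultimately show "\<exists>w. a = ty l X w" by blast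
next
  assume "\<exists>w. a = ty l X w"
  then obtain w where a: "a = ty l X w" ..
  have "\<not> consistent l b" if b: "a \<subset> b" "b \<subseteq> X" for b
  proof
    assume "consistent l b"
    then obtain v where v: "\<forall>f\<in>b. csat l v f"
      using consistent_iff[OF finite_subset[OF b(2) assms(1)]] by blast
    then have "ty l X v = ty l X w" using a b by (intro ty_eqI assms(2)) auto
    moreover have "b \<subseteq> ty l X v" using v b by (auto simp: ty_def)
    ultimately show False using a b by blast
  qed
  moreover have "a \<subseteq> X" by (auto simp: a ty_def)
  ultimately show "max_consistent_in l X a"
    unfolding max_consistent_in_def using a ty_consistent[OF assms(1)] by blast
qed

lemma maximal_iff: "maximal l \<phi> a \<longleftrightarrow> (\<exists>w. a = ty l (sub_bar \<phi>) w)"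
  unfolding maximal_def by (intro max_consistent_iff) (auto intro: neg_sub_bar)

lemma max_consistent_upto_iff:
  "max_consistent_in l (sub_bar_upto d \<phi>) a \<longleftrightarrow> (\<exists>w. a = ty l (sub_bar_upto d \<phi>) w)"
  by (intro max_consistent_iff) (auto simp: sub_bar_upto_def intro: neg_sub_bar)

lemma sub_bar_upto_md: "md \<phi> \<le> d \<Longrightarrow> sub_bar_upto d \<phi> = sub_bar \<phi>"
  using sub_bar_md by (fastforce simp: sub_bar_upto_def)

lemma finite_sub_bar_upto [simp]: "finite (sub_bar_upto d \<phi>)"
  by (simp add: sub_bar_upto_def)

text \<open>Components are never deeper than the formula, so the depth bound does no harm; a bound
  of at least \<open>md \<phi>\<close> gives the full type.\<close>

lemma ty_closed: "closed l \<phi> (ty l (sub_bar_upto d \<phi>) w)"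
  unfolding closed_def
proof (intro conjI allI impI ballI)
  fix f g assume "And f g \<in> ty l (sub_bar_upto d \<phi>) w"
  then show "f \<in> ty l (sub_bar_upto d \<phi>) w" "g \<in> ty l (sub_bar_upto d \<phi>) w"
    using sub_bar_And[of f g \<phi>] by (auto simp: ty_def sub_bar_upto_def)
next
  fix f g assume "Or f g \<in> ty l (sub_bar_upto d \<phi>) w"
  then show "f \<in> ty l (sub_bar_upto d \<phi>) w \<or> g \<in> ty l (sub_bar_upto d \<phi>) w"
    using sub_bar_Or[of f g \<phi>] by (auto simp: ty_def sub_bar_upto_def)
next
  fix f assume T: "has_T l" and f: "Box f \<in> ty l (sub_bar_upto d \<phi>) w"
  from T have "cR l w w" using frame_cR[of l] by (simp add: frame_def reflpD)
  then show "f \<in> ty l (sub_bar_upto d \<phi>) w"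
    using f sub_bar_Box[of f \<phi>] by (simp add: ty_def sub_bar_upto_def)
next
  fix p assume "p \<in> vars \<phi>"
  then have "Pos p \<in> sub_bar \<phi>" "Neg p \<in> sub_bar \<phi>" using sub_bar_var by simp_all
  then show "Pos p \<in> ty l (sub_bar_upto d \<phi>) w \<or> Neg p \<in> ty l (sub_bar_upto d \<phi>) w"
    by (simp add: ty_def sub_bar_upto_def)
qed

lemma incompleteI:
  assumes "g \<in> lang (vars \<phi>)" "csat l x \<phi>" "csat l x g" "csat l y \<phi>" "\<not> csat l y g"
  shows "incomplete l \<phi>"
  using assms by (auto simp: incomplete_def complete_def derivable_iff)

section \<open>Adding a root\<close>

text \<open>\<open>None\<close> is a new root over the canonical model with the points of
  \<open>X\<close> as successors; the other edges from the root supply the reflexivity and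
  transitivity that the logic requires.\<close>

definition glueR :: "logic \<Rightarrow> fm set set \<Rightarrow> fm set option \<Rightarrow> fm set option \<Rightarrow> bool" where
  "glueR l X w v \<longleftrightarrow>
     (case (w, v) of
        (None, None) \<Rightarrow> has_T l
      | (None, Some y) \<Rightarrow> y \<in> X \<or> has_4 l \<and> (\<exists>x\<in>X. cR l x y)
      | (Some x, None) \<Rightarrow> False
      | (Some x, Some y) \<Rightarrow> cR l x y)"

definition glueV :: "state \<Rightarrow> fm set option \<Rightarrow> nat \<Rightarrow> bool" where
  "glueV a w p \<longleftrightarrow> (case w of None \<Rightarrow> Pos p \<in> a | Some x \<Rightarrow> cV x p)"

lemma glueR_simps [simp]:
  "glueR l X None None \<longleftrightarrow> has_T l"
  "glueR l X None (Some y) \<longleftrightarrow> y \<in> X \<or> has_4 l \<and> (\<exists>x\<in>X. cR l x y)"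
  "\<not> glueR l X (Some x) None"
  "glueR l X (Some x) (Some y) \<longleftrightarrow> cR l x y"
  by (simp_all add: glueR_def)

lemma frame_glueR:
  assumes "has_D l \<Longrightarrow> X \<noteq> {}"
  shows "frame l (glueR l X)"
  unfolding frame_def
proof (intro conjI impI)
  assume "has_T l"
  then have "cR l x x" for x using frame_cR[of l] by (simp add: frame_def reflpD)
  then have "glueR l X w w" for w using \<open>has_T l\<close> by (cases w) simp_all
  then show "reflp (glueR l X)" by (rule reflpI)
next
  assume "has_4 l"
  show "transp (glueR l X)"
  proof (rule transpI)
    fix u v w assume "glueR l X u v" "glueR l X v w"
    then show "glueR l X u w"
      using \<open>has_4 l\<close> by (cases u; cases v; cases w; simp) (use trans_cR in blast)+
  qed
next
  assume D: "has_D l"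
  show "\<forall>w. \<exists>v. glueR l X w v"
  proof
    fix w
    show "\<exists>v. glueR l X w v"
    proof (cases w)
      case None
      obtain x where "x \<in> X" using assms D by blast
      then have "glueR l X w (Some x)" using None by simp
      then show ?thesis ..
    next
      case (Some x)
      obtain y where "cR l x y" using D frame_cR[of l] by (auto simp: frame_def)
      then have "glueR l X w (Some y)" using Some by simp
      then show ?thesis ..
    qed
  qed
qed

text \<open>No edge leads back to the root, so the canonical model is a generated submodel.\<close>

lemma sat_glue_Some [simp]: "sat (glueR l X) (glueV a) (Some x) f \<longleftrightarrow> csat l x f"
proof (induction f arbitrary: x)
  case (Box f)
  then show ?case by (simp add: split_option_all)
next
  case (Dia f)
  then show ?case by (simp add: split_option_ex)
qed (auto simp: glueV_def)

text \<open>A Hintikka-style argument. Membership only implies truth, since the parent of a view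
  need not be maximal. Consistency excludes complementary literals, and closure under T handles the
  loop at the root.\<close>

lemma sat_glue_None:
  assumes "closed l \<phi> a" "consistent l a" "finite a"
    and "\<And>f. Dia f \<in> a \<Longrightarrow> \<exists>x\<in>X. csat l x f"
    and "\<And>f x. Box f \<in> a \<Longrightarrow> x \<in> X \<Longrightarrow> csat l x f"
    and "\<And>f x. has_4 l \<Longrightarrow> Box f \<in> a \<Longrightarrow> x \<in> X \<Longrightarrow> csat l x (Box f)"
  shows "f \<in> a \<Longrightarrow> sat (glueR l X) (glueV a) None f"
proof (induction f)
  case Falsum
  then show ?case using assms(2,3) by (auto simp: consistent_iff)
next
  case (Neg p)
  obtain w where w: "\<forall>f\<in>a. csat l w f" using assms(2) consistent_iff[OF assms(3)] by blast
  have "Pos p \<notin> a"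
  proof
    assume "Pos p \<in> a"
    then show False using Neg bspec[OF w, of "Pos p"] bspec[OF w, of "Neg p"] by simp
  qed
  then show ?case by (simp add: glueV_def)
next
  case (Box f)
  have "sat (glueR l X) (glueV a) v f" if "glueR l X None v" for v
  proof (cases v)
    case None
    then have "has_T l" using that by simp
    then have "f \<in> a" using assms(1) Box.prems unfolding closed_def by blast
    then show ?thesis using None Box.IH by simp
  next
    case (Some y)
    then consider "y \<in> X" | x where "has_4 l" "x \<in> X" "cR l x y" using \<open>glueR l X None v\<close> by auto
    then have "csat l y f"
    proof cases
      case 1
      then show ?thesis using assms(5) Box.prems by blast
    next
      case 2
      then have "csat l x (Box f)" using assms(6) Box.prems by blast
      then show ?thesis using 2(3) by simp
    qed
    then show ?thesis using Some by simp
  qed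
  then show ?case by simp
next
  case (Dia f)
  then obtain x where "x \<in> X" "csat l x f" using assms(4) by blast
  then have "glueR l X None (Some x) \<and> sat (glueR l X) (glueV a) (Some x) f" by simp
  then show ?case unfolding sat.simps by blast
next
  case (And f g)
  then have "f \<in> a" "g \<in> a" using assms(1) unfolding closed_def by blast+
  then show ?case using And.IH by simp
next
  case (Or f g)
  then have "f \<in> a \<or> g \<in> a" using assms(1) unfolding closed_def by blast
  then show ?case using Or.IH by auto
qed (simp_all add: glueV_def)

section \<open>Roots above the children of a constructed view\<close>

lemma construct_states:
  assumes "cc_construct l \<phi> a S"
  shows "a \<subseteq> sub_bar \<phi>" "finite a"
    and "c \<in> children S \<Longrightarrow> c \<subseteq> sub_bar \<phi>" "c \<in> children S \<Longrightarrow> finite c"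
proof -
  have "is_view \<phi> S" "a \<subseteq> parent S"
    using assms by (auto simp: cc_construct_def completes_def)
  then show a: "a \<subseteq> sub_bar \<phi>" and c: "c \<in> children S \<Longrightarrow> c \<subseteq> sub_bar \<phi>"
    by (auto simp: is_view_def is_state_def)
  show "finite a" by (rule finite_subset[OF a]) simp
  show "finite c" if "c \<in> children S" by (rule finite_subset[OF c[OF that]]) simp
qed

lemma construct_witnesses:
  assumes "cc_construct l \<phi> a S"
  obtains W where "\<forall>c\<in>children S. \<forall>f\<in>c. csat l (W c) f"
proof -
  have "\<exists>w. \<forall>f\<in>c. csat l w f" if "c \<in> children S" for c
  proof -
    have "consistent l c" using assms that by (simp add: cc_construct_def view_consistent_def)
    then show ?thesis by (simp only: consistent_iff[OF construct_states(4)[OF assms that]])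
  qed
  then obtain W where "\<forall>c\<in>children S. \<forall>f\<in>c. csat l (W c) f"
    using bchoice[of "children S" "\<lambda>c w. \<forall>f\<in>c. csat l w f"] by blast
  then show ?thesis by (rule that)
qed

lemma view_completeD:
  assumes "view_complete l \<phi> S"
  shows "closed l \<phi> (parent S)"
    and "Dia f \<in> parent S \<Longrightarrow> \<exists>c\<in>children S. f \<in> c"
    and "Box f \<in> parent S \<Longrightarrow> c \<in> children S \<Longrightarrow> f \<in> c"
    and "has_4 l \<Longrightarrow> Box f \<in> parent S \<Longrightarrow> c \<in> children S \<Longrightarrow> Box f \<in> c"
    and "has_D l \<Longrightarrow> children S \<noteq> {}"
proof -
  note * = assms[unfolded view_complete_def]
  show "closed l \<phi> (parent S)" using * by (elim conjE)
  have "\<forall>f. Dia f \<in> parent S \<longrightarrow> f \<in> \<Union> (children S)" using * by (elim conjE)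
  then show "Dia f \<in> parent S \<Longrightarrow> \<exists>c\<in>children S. f \<in> c" by simp
  have "\<forall>f. Box f \<in> parent S \<longrightarrow> (\<forall>c\<in>children S. f \<in> c)" using * by (elim conjE)
  then show "Box f \<in> parent S \<Longrightarrow> c \<in> children S \<Longrightarrow> f \<in> c" by simp
  have "has_4 l \<longrightarrow> (\<forall>f. Box f \<in> parent S \<longrightarrow> (\<forall>c\<in>children S. Box f \<in> c))"
    using * by (elim conjE)
  then show "has_4 l \<Longrightarrow> Box f \<in> parent S \<Longrightarrow> c \<in> children S \<Longrightarrow> Box f \<in> c" by simp
  show "has_D l \<Longrightarrow> children S \<noteq> {}" using * by (elim conjE) simp
qed

text \<open>The root over the witnesses \<open>W\<close> satisfies the parent, hence
  \<open>a\<close>. The equivalence determines every diamond at the root, also outside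
  \<open>sub_bar \<phi>\<close>, so the effect of exchanging a witness can be computed.\<close>

lemma construct_glue:
  assumes S: "cc_construct l \<phi> a S"
    and W: "\<forall>c\<in>children S. \<forall>f\<in>c. csat l (W c) f"
  obtains x where "\<forall>f\<in>a. csat l x f"
    "\<And>f. csat l x (Dia f) \<longleftrightarrow> has_T l \<and> csat l x f \<or>
       (\<exists>c\<in>children S. csat l (W c) f \<or> has_4 l \<and> csat l (W c) (Dia f))"
proof -
  let ?X = "W ` children S"
  have vc: "view_complete l \<phi> S" and con: "consistent l (parent S)"
    and par: "a \<subseteq> parent S" "parent S \<subseteq> sub_bar \<phi>"
    using S unfolding cc_construct_def completes_def view_consistent_def is_view_def is_state_def
    by simp_all
  have fin: "finite (parent S)" by (rule finite_subset[OF par(2)]) simp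
  have "frame l (glueR l ?X)"
    by (rule frame_glueR) (simp add: view_completeD(5)[OF vc])
  from canonical_twin[OF this, of "glueV (parent S)" None] obtain x where
    x: "\<And>f. csat l x f \<longleftrightarrow> sat (glueR l ?X) (glueV (parent S)) None f" by blast
  have root: "csat l x f" if "f \<in> parent S" for f
    unfolding x
  proof (rule sat_glue_None[OF _ con fin _ _ _ that])
    show "closed l \<phi> (parent S)" by (rule view_completeD(1)[OF vc])
  next
    fix g assume "Dia g \<in> parent S"
    then obtain c where "c \<in> children S" "g \<in> c" using view_completeD(2)[OF vc] by blast
    then show "\<exists>x\<in>?X. csat l x g" using W by blast
  next
    fix g y assume g: "Box g \<in> parent S" "y \<in> ?X"
    then obtain c where c: "c \<in> children S" "y = W c" by blast
    then have "g \<in> c" using view_completeD(3)[OF vc g(1)] by simp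
    then show "csat l y g" using W c by blast
  next
    fix g y assume g: "has_4 l" "Box g \<in> parent S" "y \<in> ?X"
    then obtain c where c: "c \<in> children S" "y = W c" by blast
    then have "Box g \<in> c" using view_completeD(4)[OF vc g(1,2)] by simp
    then show "csat l y (Box g)" using W c by blast
  qed
  have dia: "csat l x (Dia f) \<longleftrightarrow> has_T l \<and> csat l x f \<or>
      (\<exists>c\<in>children S. csat l (W c) f \<or> has_4 l \<and> csat l (W c) (Dia f))" for f
    unfolding x by (simp add: split_option_ex) blast
  have "\<forall>f\<in>a. csat l x f" using root par(1) by blast
  then show ?thesis using dia by (rule that)
qed

text \<open>\<open>th a\<close> never refutes \<open>Dia (th c)\<close> for a child
  \<open>c\<close>; when the procedure accepts because of \<open>c\<close>, it does not prove it
  either.\<close>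

lemma construct_Dia_child:
  assumes S: "cc_construct l \<phi> a S" and c: "c \<in> children S"
  obtains x where "\<forall>f\<in>a. csat l x f" "csat l x (Dia (th c))"
proof -
  obtain W where W: "\<forall>c\<in>children S. \<forall>f\<in>c. csat l (W c) f"
    by (rule construct_witnesses[OF S])
  obtain x where x: "\<forall>f\<in>a. csat l x f"
    "\<And>f. csat l x (Dia f) \<longleftrightarrow> has_T l \<and> csat l x f \<or>
       (\<exists>c\<in>children S. csat l (W c) f \<or> has_4 l \<and> csat l (W c) (Dia f))"
    by (rule construct_glue[OF S W]) (rule that)
  have "csat l (W c) (th c)" using W c construct_states(4)[OF S c] by simp
  then have "csat l x (Dia (th c))" unfolding x(2) using c by blast
  with x(1) show ?thesis by (rule that)
qed

section \<open>Acceptance implies incompleteness for K\<close>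

text \<open>Separation is stated for two models of the current state rather than of
  \<open>\<phi>\<close>, so that the induction carries it from a child up to its parent.\<close>

lemma K_loop_incomplete:
  assumes "cc_loop l \<phi> a N r" "l = K" "r = Accept"
  shows "\<exists>g x y. g \<in> lang (vars \<phi>) \<and> (\<forall>f\<in>a. csat K x f) \<and> csat K x g \<and>
    (\<forall>f\<in>a. csat K y f) \<and> \<not> csat K y g"
  using assms
proof (induction rule: cc_loop.induct)
  case (cond_accept a S N)
  then have S: "cc_construct K \<phi> a S" by simp
  obtain c where c: "c \<in> children S" "\<not> derivable K (Imp (th a) (Dia (th c)))"
    using cond_accept by (auto simp: cc_accept_cond_def)
  obtain x where "\<forall>f\<in>a. csat K x f" "csat K x (Dia (th c))"
    by (rule construct_Dia_child[OF S c(1)])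
  moreover obtain y where "csat K y (th a)" "\<not> csat K y (Dia (th c))"
    using c(2) by (auto simp: derivable_iff)
  then have "\<forall>f\<in>a. csat K y f" using construct_states(2)[OF S] by simp
  moreover have "Dia (th c) \<in> lang (vars \<phi>)"
    using vars_th[OF construct_states(3)[OF S c(1)]] by (simp add: lang_def)
  ultimately show ?case using \<open>\<not> csat K y (Dia (th c))\<close> by blast
next
  case (next_continue a S c N r)
  then obtain g u v where g: "g \<in> lang (vars \<phi>)"
    and u: "\<forall>f\<in>c. csat K u f" "csat K u g" and v: "\<forall>f\<in>c. csat K v f" "\<not> csat K v g" by blast
  have S: "cc_construct K \<phi> a S" and c: "c \<in> children S" using next_continue by simp_all
  have Kmax: "K_maximal \<phi> S c'" if "c' \<in> children S" for c'
    using S that by (simp add: cc_construct_def completes_def)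
  note finc = construct_states(4)[OF S c]
  obtain W where W: "\<forall>c\<in>children S. \<forall>f\<in>c. csat K (W c) f"
    by (rule construct_witnesses[OF S])
  \<comment> \<open>The conjunct \<open>th c\<close> makes the diamond ignore the other children, so
    it reports whether \<open>g\<close> holds at the witness of \<open>c\<close>.\<close>
  let ?G = "Dia (And (th c) g)"
  \<comment> \<open>\<open>W c'\<close> realizes both types \<open>c\<close> and \<open>c'\<close>
    over the same set \<open>?X\<close>, so they coincide.\<close>
  have eq: "c' = c" if c': "c' \<in> children S" "csat K (W c') (th c)" for c'
  proof -
    let ?X = "sub_bar_upto (Max (md_state ` children S)) \<phi>"
    obtain w w' where w: "c = ty K ?X w" "c' = ty K ?X w'"
      using Kmax[OF c'(1)] Kmax[OF c] by (auto simp: K_maximal_def max_consistent_upto_iff)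
    have neg: "\<And>f. f \<in> ?X \<Longrightarrow> neg f \<in> ?X" by (simp add: sub_bar_upto_def neg_sub_bar)
    have "ty K ?X (W c') = ty K ?X w" using c'(2) finc w(1) by (intro ty_eqI neg) simp_all
    moreover have "ty K ?X (W c') = ty K ?X w'"
      using bspec[OF W c'(1)] unfolding w(2) by (intro ty_eqI neg)
    ultimately show ?thesis using w by simp
  qed
  \<comment> \<open>Only the witness of \<open>c\<close> is exchanged; \<open>z\<close> will be
    \<open>u\<close> and then \<open>v\<close>.\<close>
  have glue: "\<exists>x. (\<forall>f\<in>a. csat K x f) \<and>
    (csat K x ?G \<longleftrightarrow> (\<exists>c'\<in>children S. csat K ((W(c := z)) c') (And (th c) g)))"
    if z: "\<forall>f\<in>c. csat K z f" for z
  proof -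
    have "\<forall>c'\<in>children S. \<forall>f\<in>c'. csat K ((W(c := z)) c') f" using W z by simp
    then obtain x where x: "\<forall>f\<in>a. csat K x f"
      "\<And>f. csat K x (Dia f) \<longleftrightarrow> has_T K \<and> csat K x f \<or>
       (\<exists>c'\<in>children S. csat K ((W(c := z)) c') f \<or> has_4 K \<and> csat K ((W(c := z)) c') (Dia f))"
      by (rule construct_glue[OF S]) (rule that)
    have "csat K x ?G \<longleftrightarrow> (\<exists>c'\<in>children S. csat K ((W(c := z)) c') (And (th c) g))"
      unfolding x(2) by (simp add: has_T_def has_4_def)
    then show ?thesis using x(1) by blast
  qed
  obtain x where x: "\<forall>f\<in>a. csat K x f"
    "csat K x ?G \<longleftrightarrow> (\<exists>c'\<in>children S. csat K ((W(c := u)) c') (And (th c) g))"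
    using glue[OF u(1)] by blast
  have "csat K ((W(c := u)) c) (And (th c) g)" using u finc by simp
  then have xG: "csat K x ?G" using x(2) c by blast
  obtain y where y: "\<forall>f\<in>a. csat K y f"
    "csat K y ?G \<longleftrightarrow> (\<exists>c'\<in>children S. csat K ((W(c := v)) c') (And (th c) g))"
    using glue[OF v(1)] by blast
  have "\<not> csat K ((W(c := v)) c') (And (th c) g)" if "c' \<in> children S" for c'
    using eq[OF that] v(2) by (cases "c' = c") auto
  then have yG: "\<not> csat K y ?G" using y(2) by blast
  have "?G \<in> lang (vars \<phi>)"
    using vars_th[OF construct_states(3)[OF S c]] g by (simp add: lang_def)
  then show ?case using x(1) xG y(1) yG by blast
qed simp_all

section \<open>Acceptance implies incompleteness for the transitive logics\<close>

text \<open>Here \<open>c\<close> is the state at which the procedure accepts because of the child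
  \<open>e\<close>. Transitivity merges the diamonds along the run into one, so the states in
  between can be forgotten. The last conjunct comes from \<open>construct_Dia_child\<close>.\<close>

lemma trans_loop_accept:
  assumes "cc_loop l \<phi> a N r" "has_4 l" "r = Accept" "maximal l \<phi> a"
  shows "\<exists>c e. maximal l \<phi> c \<and> e \<subseteq> sub_bar \<phi> \<and> (c = a \<or> derivable l (Imp (th a) (Dia (th c)))) \<and>
    \<not> derivable l (Imp (th c) (Dia (th e))) \<and> (\<exists>x. csat l x (th c) \<and> csat l x (Dia (th e)))"
  using assms
proof (induction rule: cc_loop.induct)
  case (cond_accept a S N)
  note S = cond_accept.hyps(1)
  obtain c where c: "c \<in> children S" "\<not> derivable l (Imp (th a) (Dia (th c)))"
    using cond_accept by (auto simp: cc_accept_cond_def)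
  obtain x where "\<forall>f\<in>a. csat l x f" "csat l x (Dia (th c))"
    by (rule construct_Dia_child[OF S c(1)])
  moreover from this have "csat l x (th a)" using construct_states(2)[OF S] by simp
  ultimately show ?case using cond_accept.prems c construct_states(3)[OF S c(1)] by blast
next
  case (next_continue a S c N r)
  then have max: "maximal l \<phi> c" and ac: "derivable l (Imp (th a) (Dia (th c)))"
    by (auto simp: cc_construct_def completes_def cc_accept_cond_def)
  have ad: "derivable l (Imp (th a) (Dia (th d)))"
    if cd: "derivable l (Imp (th c) (Dia (th d)))" for d
    unfolding derivable_iff
  proof
    fix w
    have "csat l w (Dia (th d))" if "csat l w (th a)"
    proof -
      obtain v where v: "cR l w v" "csat l v (th c)"
        using ac \<open>csat l w (th a)\<close> by (auto simp: derivable_iff)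
      then obtain u where "cR l v u" "csat l u (th d)" using cd by (auto simp: derivable_iff)
      then show ?thesis using trans_cR[OF next_continue.prems(1) v(1)] by auto
    qed
    then show "csat l w (Imp (th a) (Dia (th d)))" by simp
  qed
  from next_continue.IH[OF next_continue.prems(1,2) max] show ?case using ac ad by metis
qed simp_all

text \<open>All points satisfying the state \<open>c\<close> are replaced by the submodel generated by one point \<open>m\<close>
  satisfying \<open>c\<close>: an edge to a point of \<open>c\<close> becomes edges to the whole copy of that submodel. The
  points \<^term>\<open>Inl w\<close> with \<open>w\<close> satisfying \<open>c\<close> remain in the type but are unreachable from
  elsewhere.\<close>

definition replR :: "logic \<Rightarrow> fm set \<Rightarrow> fm set \<Rightarrow> fm set + fm set \<Rightarrow> fm set + fm set \<Rightarrow> bool" where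
  "replR l c m w v \<longleftrightarrow>
     (case (w, v) of
        (Inl x, Inl y) \<Rightarrow> cR l x y \<and> (\<not> csat l y (th c) \<or> x = y)
      | (Inl x, Inr y) \<Rightarrow> (\<exists>z. cR l x z \<and> csat l z (th c)) \<and> (y = m \<or> cR l m y)
      | (Inr x, Inl y) \<Rightarrow> False
      | (Inr x, Inr y) \<Rightarrow> cR l x y)"

definition replV :: "fm set + fm set \<Rightarrow> nat \<Rightarrow> bool" where
  "replV w = case_sum cV cV w"

lemma replR_simps [simp]:
  "replR l c m (Inl x) (Inl y) \<longleftrightarrow> cR l x y \<and> (\<not> csat l y (th c) \<or> x = y)"
  "replR l c m (Inl x) (Inr y) \<longleftrightarrow> (\<exists>z. cR l x z \<and> csat l z (th c)) \<and> (y = m \<or> cR l m y)"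
  "\<not> replR l c m (Inr x) (Inl y)"
  "replR l c m (Inr x) (Inr y) \<longleftrightarrow> cR l x y"
  by (simp_all add: replR_def)

text \<open>The loops that \<open>replR\<close> keeps on points of \<open>c\<close> preserve
  reflexivity; seriality survives because an edge to a point of \<open>c\<close> yields one to
  \<open>Inr m\<close>.\<close>

lemma frame_replR:
  assumes "has_4 l"
  shows "frame l (replR l c m)"
  unfolding frame_def
proof (intro conjI impI)
  assume "has_T l"
  then have "cR l x x" for x using frame_cR[of l] by (simp add: frame_def reflpD)
  then have "replR l c m w w" for w by (cases w) simp_all
  then show "reflp (replR l c m)" by (rule reflpI)
next
  show "transp (replR l c m)"
  proof (rule transpI)
    fix u v w assume "replR l c m u v" "replR l c m v w"
    then show "replR l c m u w"
      by (cases u; cases v; cases w; simp) (use trans_cR[OF assms] in blast)+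
  qed
next
  assume D: "has_D l"
  then have D: "\<exists>y. cR l x y" for x using frame_cR[of l] by (simp add: frame_def)
  show "\<forall>w. \<exists>v. replR l c m w v"
  proof
    fix w
    show "\<exists>v. replR l c m w v"
    proof (cases w)
      case (Inl x)
      obtain y where y: "cR l x y" using D by blast
      show ?thesis
      proof (cases "csat l y (th c)")
        case True
        then have "replR l c m w (Inr m)" using y Inl by auto
        then show ?thesis ..
      next
        case False
        then have "replR l c m w (Inl y)" using y Inl by simp
        then show ?thesis ..
      qed
    next
      case (Inr x)
      obtain y where "cR l x y" using D by blast
      then have "replR l c m w (Inr y)" using Inr by simp
      then show ?thesis ..
    qed
  qed
qed

lemma sat_repl_Inr [simp]: "sat (replR l c m) replV (Inr x) f \<longleftrightarrow> csat l x f"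
proof (induction f arbitrary: x)
  case (Box f)
  then show ?case by (simp add: split_sum_all)
next
  case (Dia f)
  then show ?case by (simp add: split_sum_ex)
qed (simp_all add: replV_def)

text \<open>Points satisfying \<open>c\<close> agree with \<open>m\<close> on
  \<open>sub_bar \<phi>\<close>, so \<open>m\<close> can stand in for them. For the rest of the
  copy, \<open>Box f\<close> passes by transitivity from \<open>x\<close> to such a point and hence
  to \<open>m\<close>.\<close>

lemma sat_repl_Box:
  assumes "c = ty l (sub_bar \<phi>) m" "has_4 l" "Box f \<in> sub_bar \<phi>" "\<not> csat l x (th c)"
    and IH: "\<And>y. \<not> csat l y (th c) \<Longrightarrow> sat (replR l c m) replV (Inl y) f \<longleftrightarrow> csat l y f"
  shows "sat (replR l c m) replV (Inl x) (Box f) \<longleftrightarrow> csat l x (Box f)"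
proof
  have f: "f \<in> sub_bar \<phi>" using assms(3) sub_bar_Box by blast
  have same: "csat l z g \<longleftrightarrow> csat l m g" if "csat l z (th c)" "g \<in> sub_bar \<phi>" for z g
  proof -
    have "ty l (sub_bar \<phi>) z = ty l (sub_bar \<phi>) m"
      using that assms(1) by (intro ty_eqI neg_sub_bar) auto
    then show ?thesis using that(2) by (rule ty_eqD)
  qed
  {
    assume L: "sat (replR l c m) replV (Inl x) (Box f)"
    have "csat l y f" if y: "cR l x y" for y
    proof (cases "csat l y (th c)")
      case True
      then have "replR l c m (Inl x) (Inr m)" using y by (auto simp: replR_def)
      then have "csat l m f" using L by (metis sat.simps(7) sat_repl_Inr)
      then show ?thesis using same True f by simp
    next
      case False
      then have "replR l c m (Inl x) (Inl y)" using y by (auto simp: replR_def)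
      then show ?thesis using L IH[OF False] by auto
    qed
    then show "csat l x (Box f)" by simp
  next
    assume R: "csat l x (Box f)"
    have "sat (replR l c m) replV v f" if v: "replR l c m (Inl x) v" for v
    proof (cases v)
      case (Inl y)
      then have "cR l x y" "\<not> csat l y (th c)" using v assms(4) by (auto simp: replR_def)
      then show ?thesis using R IH Inl by auto
    next
      case (Inr y)
      then obtain z where z: "cR l x z" "csat l z (th c)" and y: "y = m \<or> cR l m y"
        using v by (auto simp: replR_def)
      have "csat l z f" "csat l z (Box f)"
        using R z(1) trans_cR[OF assms(2) z(1)] by simp_all
      then have "csat l m f" "csat l m (Box f)"
        using same[OF z(2)] f assms(3) by blast+
      then show ?thesis using y Inr by auto
    qed
    then show "sat (replR l c m) replV (Inl x) (Box f)" by simp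
  }
qed

lemma sat_repl_Inl:
  assumes "c = ty l (sub_bar \<phi>) m" "has_4 l"
  shows "f \<in> sub_bar \<phi> \<Longrightarrow> \<not> csat l x (th c) \<Longrightarrow>
    sat (replR l c m) replV (Inl x) f \<longleftrightarrow> csat l x f"
proof (induction f arbitrary: x)
  case (And f g)
  then show ?case using And.IH[OF _ And.prems(2)] sub_bar_And[OF And.prems(1)] by simp
next
  case (Or f g)
  then show ?case using Or.IH[OF _ Or.prems(2)] sub_bar_Or[OF Or.prems(1)] by simp
next
  case (Box f)
  show ?case
    using Box.IH sub_bar_Box[OF Box.prems(1)] by (intro sat_repl_Box[OF assms Box.prems]) simp
next
  case (Dia f)
  have "Box (neg f) \<in> sub_bar \<phi>" using neg_sub_bar[OF Dia.prems(1)] by simp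
  from sat_repl_Box[OF assms this Dia.prems(2)] show ?case
    unfolding sat_Dia_dual using Dia.IH[OF sub_bar_Dia[OF Dia.prems(1)]] by simp
qed (auto simp: replV_def)

text \<open>Since \<open>c \<noteq> a\<close>, the point \<open>x\<close> lies outside
  \<open>c\<close> and keeps its type. The only points of \<open>c\<close> it can reach lie in the
  copy generated by \<open>m\<close>, so diamonds guarded by \<open>th c\<close> describe that copy
  alone.\<close>

lemma repl_canonical:
  assumes "a = ty l (sub_bar \<phi>) x" "maximal l \<phi> c" "c \<noteq> a" "has_4 l"
    and "derivable l (Imp (th a) (Dia (th c)))" "csat l m (th c)"
  obtains y where "\<forall>f\<in>a. csat l y f"
    "\<And>f. csat l y (Dia (And (th c) f)) \<longleftrightarrow>
      (\<exists>z. (z = m \<or> cR l m z) \<and> csat l z (And (th c) f))"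
proof -
  obtain w where w: "c = ty l (sub_bar \<phi>) w" using assms(2) maximal_iff by blast
  have c: "c = ty l (sub_bar \<phi>) m"
    unfolding w by (rule ty_eqI[symmetric]) (use assms(6) w in \<open>auto simp: neg_sub_bar\<close>)
  have finc: "finite c" using w by simp
  have x: "\<not> csat l x (th c)"
  proof
    assume "csat l x (th c)"
    then have "ty l (sub_bar \<phi>) x = c"
      unfolding w by (intro ty_eqI) (use w in \<open>auto simp: neg_sub_bar\<close>)
    then show False using assms(1,3) by simp
  qed
  let ?M = "sat (replR l c m) replV"
  obtain y where y: "\<And>f. csat l y f \<longleftrightarrow> ?M (Inl x) f"
    using canonical_twin[OF frame_replR[OF assms(4), of c m], of replV "Inl x"] by blast
  have "csat l x (th a)" using assms(1) by (auto simp: ty_def)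
  then have "csat l x (Dia (th c))" using assms(5) by (auto simp: derivable_iff)
  then have ex: "\<exists>z. cR l x z \<and> csat l z (th c)" by simp
  \<comment> \<open>\<open>th c\<close> need not belong to \<open>sub_bar \<phi>\<close>, but one of
    its conjuncts fails at \<open>v\<close> and is covered by \<open>sat_repl_Inl\<close>.\<close>
  have Inl: "\<not> ?M (Inl v) (th c)" if v: "\<not> csat l v (th c)" for v
  proof -
    obtain f where f: "f \<in> c" "\<not> csat l v f" using v finc by auto
    then have "f \<in> sub_bar \<phi>" using w by (simp add: ty_def)
    then have "\<not> ?M (Inl v) f" using sat_repl_Inl[OF c assms(4) _ v] f(2) by simp
    then show ?thesis using f(1) finc by auto
  qed
  have "csat l y (Dia (And (th c) f)) \<longleftrightarrow>
      (\<exists>z. (z = m \<or> cR l m z) \<and> csat l z (And (th c) f))" for f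
  proof
    assume "csat l y (Dia (And (th c) f))"
    then obtain v where v: "replR l c m (Inl x) v" "?M v (th c)" "?M v f"
      unfolding y unfolding sat.simps(5,8) by blast
    show "\<exists>z. (z = m \<or> cR l m z) \<and> csat l z (And (th c) f)"
    proof (cases v)
      case (Inl z)
      then have "\<not> csat l z (th c)" using v(1) x by auto
      then show ?thesis using \<open>\<And>v. \<not> csat l v (th c) \<Longrightarrow> \<not> ?M (Inl v) (th c)\<close> v(2) Inl by blast
    next
      case (Inr z)
      then have "z = m \<or> cR l m z" using v(1) by simp
      moreover have "csat l z (And (th c) f)" using v(2,3) unfolding Inr sat_repl_Inr by simp
      ultimately show ?thesis by blast
    qed
  next
    assume "\<exists>z. (z = m \<or> cR l m z) \<and> csat l z (And (th c) f)"
    then obtain z where z: "z = m \<or> cR l m z" "csat l z (And (th c) f)" by blast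
    have "replR l c m (Inl x) (Inr z)" using ex z(1) by simp
    moreover have "?M (Inr z) (And (th c) f)" using z(2) unfolding sat_repl_Inr .
    ultimately show "csat l y (Dia (And (th c) f))" unfolding y unfolding sat.simps(8) by blast
  qed
  moreover have "\<forall>f\<in>a. csat l y f"
  proof
    fix f assume "f \<in> a"
    then have "f \<in> sub_bar \<phi>" "csat l x f" using assms(1) by (simp_all add: ty_def)
    then show "csat l y f" unfolding y using sat_repl_Inl[OF c assms(4) _ x] by simp
  qed
  ultimately show ?thesis using that by blast
qed

text \<open>\<open>m\<close> and \<open>m'\<close> both satisfy \<open>c\<close> but disagree on
  \<open>Dia (th e)\<close>; either they already separate \<open>a\<close>, or each is substituted
  for \<open>c\<close> below a model of \<open>a\<close>.\<close>

lemma trans_loop_incomplete: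
  assumes "cc_loop l \<phi> a N Accept" "has_4 l" "maximal l \<phi> a"
  shows "\<exists>g x y. g \<in> lang (vars \<phi>) \<and> (\<forall>f\<in>a. csat l x f) \<and> csat l x g \<and>
    (\<forall>f\<in>a. csat l y f) \<and> \<not> csat l y g"
proof -
  obtain c e m where c: "maximal l \<phi> c" "e \<subseteq> sub_bar \<phi>"
      "c = a \<or> derivable l (Imp (th a) (Dia (th c)))"
    and m: "csat l m (th c)" "csat l m (Dia (th e))"
    and nd: "\<not> derivable l (Imp (th c) (Dia (th e)))"
    using trans_loop_accept[OF assms(1,2) refl assms(3)] by blast
  obtain m' where m': "csat l m' (th c)" "\<not> csat l m' (Dia (th e))"
    using nd unfolding derivable_iff sat_Imp by blast
  obtain x0 where x0: "a = ty l (sub_bar \<phi>) x0" using assms(3) maximal_iff by blast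
  have cs: "c \<subseteq> sub_bar \<phi>" using c(1) by (auto simp: maximal_iff ty_def)
  have fin: "finite c" by (rule finite_subset[OF cs]) simp
  show ?thesis
  proof (cases "c = a")
    case True
    have "Dia (th e) \<in> lang (vars \<phi>)" using vars_th[OF c(2)] by (simp add: lang_def)
    moreover have "\<forall>f\<in>a. csat l m f" "\<forall>f\<in>a. csat l m' f" using m(1) m'(1) fin True by simp_all
    ultimately show ?thesis using m(2) m'(2) by blast
  next
    case False
    then have d: "derivable l (Imp (th a) (Dia (th c)))" using c(3) by blast
    let ?g = "Dia (And (th c) (Dia (th e)))"
    obtain x where x: "\<forall>f\<in>a. csat l x f"
      "csat l x ?g \<longleftrightarrow> (\<exists>z. (z = m \<or> cR l m z) \<and> csat l z (And (th c) (Dia (th e))))"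
      by (rule repl_canonical[OF x0 c(1) False assms(2) d m(1)]) (rule that)
    have xg: "csat l x ?g" unfolding x(2) by (intro exI[of _ m]) (use m in simp)
    obtain y where y: "\<forall>f\<in>a. csat l y f"
      "csat l y ?g \<longleftrightarrow> (\<exists>z. (z = m' \<or> cR l m' z) \<and> csat l z (And (th c) (Dia (th e))))"
      by (rule repl_canonical[OF x0 c(1) False assms(2) d m'(1)]) (rule that)
    \<comment> \<open>By transitivity, \<open>e\<close> is invisible from the whole submodel
      generated by \<open>m'\<close>.\<close>
    have "\<not> csat l z (Dia (th e))" if "z = m' \<or> cR l m' z" for z
    proof
      assume "csat l z (Dia (th e))"
      then obtain u where "cR l z u" "csat l u (th e)" by auto
      then have "csat l m' (Dia (th e))" using that trans_cR[OF assms(2), of m' z u] by auto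
      then show False using m'(2) by blast
    qed
    then have yg: "\<not> csat l y ?g" unfolding y(2) sat.simps(5) by blast
    have "?g \<in> lang (vars \<phi>)" using vars_th[OF c(2)] vars_th[OF cs] by (simp add: lang_def)
    then show ?thesis using x(1) xg y(1) yg by blast
  qed
qed

section \<open>Incompleteness implies acceptance\<close>

text \<open>\<open>W\<close> chooses one child per diamond and \<open>x\<close> is the extra child,
  absorbed by the strictness of \<open>card_Dia_sub_bar\<close>.\<close>

lemma card_children:
  assumes "a \<subseteq> sub_bar \<phi>"
  shows "card (insert x (W ` {f. Dia f \<in> a})) \<le> fsize \<phi>"
proof -
  have fin: "finite {f. Dia f \<in> sub_bar \<phi>}"
    by (rule finite_imageD[of Dia]) (auto intro: finite_subset[of _ "sub_bar \<phi>"] simp: inj_on_def)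
  then have fin': "finite {f. Dia f \<in> a}" by (rule rev_finite_subset) (use assms in auto)
  have "card {f. Dia f \<in> a} \<le> card {f. Dia f \<in> sub_bar \<phi>}"
    by (rule card_mono[OF fin]) (use assms in auto)
  moreover have "card (W ` {f. Dia f \<in> a}) \<le> card {f. Dia f \<in> a}"
    by (rule card_image_le[OF fin'])
  moreover have "card (insert x (W ` {f. Dia f \<in> a})) \<le> Suc (card (W ` {f. Dia f \<in> a}))"
    using fin' by (simp add: card_insert_if)
  ultimately show ?thesis using card_Dia_sub_bar[of \<phi>] by simp
qed

text \<open>A type contains \<open>f\<close> or \<open>neg f\<close> for each \<open>f\<close>, and
  both have the same depth.\<close>

lemma md_state_ty: "md_state (ty l (sub_bar_upto d \<phi>) w) = Max (insert 0 (md ` sub_bar_upto d \<phi>))"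
proof -
  have "md ` ty l (sub_bar_upto d \<phi>) w = md ` sub_bar_upto d \<phi>"
  proof (intro equalityI subsetI)
    fix n assume "n \<in> md ` sub_bar_upto d \<phi>"
    then obtain f where f: "f \<in> sub_bar_upto d \<phi>" "n = md f" by blast
    then have "neg f \<in> sub_bar_upto d \<phi>" by (auto simp: sub_bar_upto_def neg_sub_bar)
    then have "f \<in> ty l (sub_bar_upto d \<phi>) w \<or> neg f \<in> ty l (sub_bar_upto d \<phi>) w"
      using f(1) by (auto simp: ty_def)
    then show "n \<in> md ` ty l (sub_bar_upto d \<phi>) w" using f(2) md_neg image_eqI by metis
  qed (auto simp: ty_def)
  then show ?thesis by (simp add: md_state_def)
qed

lemma K_maximal_ty:
  assumes "children S \<noteq> {}" "\<And>c. c \<in> children S \<Longrightarrow> \<exists>w. c = ty K (sub_bar_upto d \<phi>) w"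
    and "c \<in> children S"
  shows "K_maximal \<phi> S c"
proof -
  \<comment> \<open>\<open>K_maximal\<close> measures the actual depth \<open>?e\<close> of the
    children, which may be below \<open>d\<close>; both bounds select the same formulas.\<close>
  let ?e = "Max (insert 0 (md ` sub_bar_upto d \<phi>))"
  have "md_state ` children S \<subseteq> {?e}"
  proof
    fix n assume "n \<in> md_state ` children S"
    then obtain c' where "c' \<in> children S" "n = md_state c'" by blast
    then show "n \<in> {?e}" using assms(2)[of c'] md_state_ty by auto
  qed
  then have "md_state ` children S = {?e}" using subset_singletonD assms(1) by fastforce
  then have e: "Max (md_state ` children S) = ?e" by simp
  have "?e \<le> d" by (auto simp: sub_bar_upto_def)
  then have "f \<in> sub_bar_upto ?e \<phi> \<Longrightarrow> f \<in> sub_bar_upto d \<phi>" for f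
    unfolding sub_bar_upto_def mem_Collect_eq by linarith
  moreover have "f \<in> sub_bar_upto ?e \<phi>" if f: "f \<in> sub_bar_upto d \<phi>" for f
  proof -
    have "md f \<le> ?e" using f by (intro Max_ge) simp_all
    then show ?thesis using f unfolding sub_bar_upto_def mem_Collect_eq by blast
  qed
  ultimately have "sub_bar_upto ?e \<phi> = sub_bar_upto d \<phi>" by blast
  then show ?thesis using assms(2,3) by (simp add: K_maximal_def e max_consistent_upto_iff)
qed

text \<open>Serves both cases: in K the children may lose one level of depth, in the transitive
  logics they are full types. The points of \<open>Z\<close> need not be successors of
  \<open>x\<close>.\<close>

lemma construct_ty:
  assumes "a = ty l (sub_bar_upto d \<phi>) x" "\<And>f. Dia f \<in> a \<Longrightarrow> \<exists>z\<in>Z. csat l z f"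
    and "\<And>f z. Box f \<in> a \<Longrightarrow> z \<in> Z \<Longrightarrow> csat l z f"
    and "\<And>f z. has_4 l \<Longrightarrow> Box f \<in> a \<Longrightarrow> z \<in> Z \<Longrightarrow> csat l z (Box f)"
    and "Z \<noteq> {}" "card (ty l (sub_bar_upto d' \<phi>) ` Z) \<le> fsize \<phi>"
    and "l = K \<Longrightarrow> d \<le> Suc d'" "has_4 l \<Longrightarrow> md \<phi> \<le> d'"
  shows "cc_construct l \<phi> a (View a (ty l (sub_bar_upto d' \<phi>) ` Z))"
proof -
  let ?S = "View a (ty l (sub_bar_upto d' \<phi>) ` Z)"
  have l: "l = K \<or> has_4 l" by (cases l) (auto simp: has_4_def)
  have a: "f \<in> a \<longleftrightarrow> f \<in> sub_bar \<phi> \<and> md f \<le> d \<and> csat l x f" for f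
    by (auto simp: assms(1) ty_def sub_bar_upto_def)
  have in_ty: "f \<in> ty l (sub_bar_upto d' \<phi>) z \<longleftrightarrow> csat l z f"
    if "f \<in> sub_bar \<phi>" "Suc (md f) \<le> d" for f z
    using that l assms(7,8) sub_bar_md[OF that(1)] by (auto simp: ty_def sub_bar_upto_def)
  have in_ty4: "f \<in> ty l (sub_bar_upto d' \<phi>) z \<longleftrightarrow> csat l z f"
    if "f \<in> sub_bar \<phi>" "has_4 l" for f z
    using that assms(8) sub_bar_md[OF that(1)] by (auto simp: ty_def sub_bar_upto_def)
  have "is_view \<phi> ?S"
    using assms(6) by (auto simp: is_view_def is_state_def assms(1) ty_def sub_bar_upto_def)
  moreover have "view_consistent l ?S"
    by (auto simp: view_consistent_def assms(1) ty_consistent)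
  moreover have "view_complete l \<phi> ?S"
    unfolding view_complete_def
  proof (intro conjI allI impI ballI)
    fix f assume f: "Dia f \<in> parent ?S"
    then obtain z where "z \<in> Z" "csat l z f" using assms(2) by auto
    then show "f \<in> \<Union> (children ?S)" using f in_ty[of f] a sub_bar_Dia[of f \<phi>] by auto
  next
    fix f c assume "Box f \<in> parent ?S" "c \<in> children ?S"
    then show "f \<in> c" using assms(3) in_ty[of f] a sub_bar_Box[of f \<phi>] by auto
  next
    fix f c assume "has_4 l" "Box f \<in> parent ?S" "c \<in> children ?S"
    then show "Box f \<in> c" using assms(4) in_ty4[of "Box f"] a by auto
  qed (use assms(5) in \<open>auto simp: assms(1) ty_closed\<close>)
  moreover have "K_maximal \<phi> ?S c" if "l = K" "c \<in> children ?S" for c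
    using that assms(5) by (intro K_maximal_ty[of ?S d']) auto
  moreover have "maximal l \<phi> c" if "has_4 l" "c \<in> children ?S" for c
    using that assms(8) by (auto simp: maximal_iff sub_bar_upto_md)
  ultimately show ?thesis by (auto simp: cc_construct_def completes_def)
qed

section \<open>Descent through modal depth in K\<close>

text \<open>\<open>h\<close> is a Boolean combination of variables and modal formulas, so points
  that agree on the variables differ on one of the latter; \<open>g\<close> is its argument, negated
  for a box.\<close>

lemma K_distinguish:
  assumes "\<And>p. p \<in> P \<Longrightarrow> csat l x (Pos p) \<longleftrightarrow> csat l y (Pos p)"
  shows "h \<in> lang P \<Longrightarrow> csat l x h \<noteq> csat l y h \<Longrightarrow>
    \<exists>g \<in> lang P. (\<exists>x'. cR l x x' \<and> csat l x' g) \<and> (\<forall>y'. cR l y y' \<longrightarrow> \<not> csat l y' g) \<or>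
      (\<exists>y'. cR l y y' \<and> csat l y' g) \<and> (\<forall>x'. cR l x x' \<longrightarrow> \<not> csat l x' g)"
proof (induction h)
  case (Box h)
  then have "neg h \<in> lang P" by (simp add: lang_def)
  then show ?case using Box.prems by (intro bexI[of _ "neg h"]) auto
next
  case (Dia h)
  then have "h \<in> lang P" by (simp add: lang_def)
  then show ?case using Dia.prems by (intro bexI[of _ h]) auto
qed (use assms in \<open>auto simp: lang_def\<close>)

text \<open>The induction runs over the depth \<open>d\<close> of the state, whereas the depth of
  \<open>h\<close> is unrestricted. Each descent costs one unit of \<open>N\<close>, whence
  \<open>d \<le> N\<close>.\<close>

lemma K_loop_accept:
  assumes "ty K (sub_bar_upto d \<phi>) x = ty K (sub_bar_upto d \<phi>) y" "h \<in> lang (vars \<phi>)"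
    "csat K x h \<noteq> csat K y h" "d \<le> N"
  shows "cc_loop K \<phi> (ty K (sub_bar_upto d \<phi>) x) N Accept"
  using assms
proof (induction d arbitrary: x y h N)
  case 0
  let ?a = "ty K (sub_bar_upto 0 \<phi>) x"
  \<comment> \<open>At depth 0 nothing in \<open>?a\<close> constrains the children, so the type of
    \<open>x\<close> itself serves as one.\<close>
  let ?S = "View ?a (ty K (sub_bar_upto 0 \<phi>) ` {x})"
  have modal: "Dia f \<notin> ?a" "Box f \<notin> ?a" for f by (auto simp: ty_def sub_bar_upto_def)
  have "card (ty K (sub_bar_upto 0 \<phi>) ` {x}) \<le> fsize \<phi>" using card_Dia_sub_bar[of \<phi>] by simp
  then have S: "cc_construct K \<phi> ?a ?S"
    by (intro construct_ty[of ?a K 0 \<phi> x]) (auto simp: modal has_4_def)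
  \<comment> \<open>A root without successors satisfies \<open>?a\<close> and refutes every
    diamond.\<close>
  obtain z where "\<forall>f\<in>?a. csat K z f" "\<not> csat K z (Dia (th ?a))"
  proof -
    have "frame K (glueR K {})" by (rule frame_glueR) (simp add: has_D_def)
    then obtain z where z: "\<And>f. csat K z f \<longleftrightarrow> sat (glueR K {}) (glueV ?a) None f"
      using canonical_twin by metis
    have "\<forall>f\<in>?a. csat K z f"
      unfolding z by (intro ballI sat_glue_None[OF ty_closed]) (auto simp: ty_consistent modal)
    moreover have "\<not> csat K z (Dia (th ?a))"
      unfolding z by (auto simp: glueR_def has_T_def has_4_def split: option.splits)
    ultimately show ?thesis using that by blast
  qed
  then have "cc_accept_cond K ?a ?S" by (auto simp: cc_accept_cond_def derivable_iff)
  then show ?case using cc_loop.cond_accept[OF S] by simp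
next
  case (Suc d)
  have main: "cc_loop K \<phi> (ty K (sub_bar_upto (Suc d) \<phi>) x) N Accept"
    if eq: "ty K (sub_bar_upto (Suc d) \<phi>) x = ty K (sub_bar_upto (Suc d) \<phi>) y"
      and g: "g \<in> lang (vars \<phi>)" and x': "cR K x x'" "csat K x' g"
      and y: "\<And>y'. cR K y y' \<Longrightarrow> \<not> csat K y' g" for x y g x'
  proof -
    let ?a = "ty K (sub_bar_upto (Suc d) \<phi>) x"
    have a: "f \<in> ?a \<Longrightarrow> csat K x f" for f by (simp add: ty_def)
    have "\<forall>f. \<exists>z. Dia f \<in> ?a \<longrightarrow> cR K x z \<and> csat K z f" using a by fastforce
    then obtain W where W: "\<And>f. Dia f \<in> ?a \<Longrightarrow> cR K x (W f) \<and> csat K (W f) f" by metis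
    let ?Z = "insert x' (W ` {f. Dia f \<in> ?a})"
    let ?t = "ty K (sub_bar_upto d \<phi>)"
    have Z: "cR K x z" if "z \<in> ?Z" for z using that W x' by auto
    have "card (insert (?t x') ((?t \<circ> W) ` {f. Dia f \<in> ?a})) \<le> fsize \<phi>"
      by (rule card_children) (auto simp: ty_def sub_bar_upto_def)
    then have card: "card (?t ` ?Z) \<le> fsize \<phi>" by (simp add: image_comp)
    have S: "cc_construct K \<phi> ?a (View ?a (?t ` ?Z))"
    proof (rule construct_ty[OF refl _ _ _ _ card])
      show "\<exists>z\<in>?Z. csat K z f" if "Dia f \<in> ?a" for f using W[OF that] that by blast
      show "csat K z f" if "Box f \<in> ?a" "z \<in> ?Z" for f z using a[OF that(1)] Z[OF that(2)] by simp
    qed (simp_all add: has_4_def)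
    show ?thesis
    proof (cases "cc_accept_cond K ?a (View ?a (?t ` ?Z))")
      case True
      then show ?thesis using cc_loop.cond_accept[OF S] by simp
    next
      case False
      \<comment> \<open>Without acceptance the diamond also holds at \<open>y\<close>; this yields a
        successor of \<open>y\<close> with the type of \<open>x'\<close> at which \<open>g\<close>
        fails.\<close>
      then have "derivable K (Imp (th ?a) (Dia (th (?t x'))))" by (auto simp: cc_accept_cond_def)
      moreover have "csat K y (th ?a)" unfolding eq by (simp add: ty_def)
      ultimately obtain y' where y': "cR K y y'" "\<forall>f\<in>?t x'. csat K y' f"
        by (auto simp: derivable_iff)
      then have "?t y' = ?t x'" by (intro ty_eqI) (auto simp: sub_bar_upto_def neg_sub_bar)
      then have "cc_loop K \<phi> (?t x') (N - 1) Accept"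
        using Suc.IH[of x' y' g "N - 1"] g x' y[OF y'(1)] Suc.prems(4) by auto
      then show ?thesis using cc_loop.next_continue[OF S _ False, of "?t x'"] Suc.prems(4) by simp
    qed
  qed
  have "csat K x (Pos p) \<longleftrightarrow> csat K y (Pos p)" if "p \<in> vars \<phi>" for p
  proof -
    have "Pos p \<in> sub_bar_upto (Suc d) \<phi>" using sub_bar_var[OF that] by (simp add: sub_bar_upto_def)
    then show ?thesis by (rule ty_eqD[OF Suc.prems(1)])
  qed
  from K_distinguish[OF this Suc.prems(2,3)] show ?case
    using main[of x y] main[of y x] Suc.prems(1) by metis
qed

section \<open>Types and possible children in the transitive logics\<close>

text \<open>The condition of Lemmon filtration for transitive logics. It contains \<open>cR\<close>
  when 4 is present and, by \<open>trans_construct\<close>, suffices for the type of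
  \<open>z\<close> to occur as a child.\<close>

definition sees :: "logic \<Rightarrow> fm \<Rightarrow> fm set \<Rightarrow> fm set \<Rightarrow> bool" where
  "sees l \<phi> x z \<longleftrightarrow> (\<forall>f. Box f \<in> ty l (sub_bar \<phi>) x \<longrightarrow> csat l z f \<and> csat l z (Box f))"

text \<open>\<open>z\<close> is the extra child; the others are real successors of \<open>x\<close>
  that witness its diamonds.\<close>

lemma trans_construct:
  assumes "has_4 l" "sees l \<phi> x z"
  shows "\<exists>S. cc_construct l \<phi> (ty l (sub_bar \<phi>) x) S \<and> ty l (sub_bar \<phi>) z \<in> children S"
proof -
  let ?t = "ty l (sub_bar \<phi>)"
  have a: "f \<in> ?t x \<Longrightarrow> csat l x f" for f by (simp add: ty_def)
  have "\<forall>f. \<exists>z. Dia f \<in> ?t x \<longrightarrow> cR l x z \<and> csat l z f" using a by fastforce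
  then obtain W where W: "\<And>f. Dia f \<in> ?t x \<Longrightarrow> cR l x (W f) \<and> csat l (W f) f" by metis
  let ?Z = "insert z (W ` {f. Dia f \<in> ?t x})"
  have "card (insert (?t z) ((?t \<circ> W) ` {f. Dia f \<in> ?t x})) \<le> fsize \<phi>"
    by (rule card_children) (auto simp: ty_def)
  then have card: "card (?t ` ?Z) \<le> fsize \<phi>" by (simp add: image_comp)
  have Z: "csat l v f \<and> csat l v (Box f)" if "Box f \<in> ?t x" "v \<in> ?Z" for v f
  proof (cases "v = z")
    case True
    then show ?thesis using assms(2) that by (auto simp: sees_def)
  next
    case False
    then have "cR l x v" using that W by auto
    then show ?thesis using a[OF that(1)] trans_cR[OF assms(1) \<open>cR l x v\<close>] by simp
  qed
  have X: "sub_bar_upto (md \<phi>) \<phi> = sub_bar \<phi>" by (simp add: sub_bar_upto_md)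
  have "cc_construct l \<phi> (?t x) (View (?t x) (ty l (sub_bar_upto (md \<phi>) \<phi>) ` ?Z))"
  proof (rule construct_ty[of _ l "md \<phi>" \<phi> x])
    show "?t x = ty l (sub_bar_upto (md \<phi>) \<phi>) x" by (simp add: X)
    show "card (ty l (sub_bar_upto (md \<phi>) \<phi>) ` ?Z) \<le> fsize \<phi>" using card by (simp add: X)
    show "\<exists>z\<in>?Z. csat l z f" if "Dia f \<in> ?t x" for f using W[OF that] that by auto
  qed (use Z in auto)
  then show ?thesis by (auto simp: X)
qed

text \<open>If no construction can accept, equality of types is a bisimulation between the parts of the
  canonical model generated by \<open>x\<close> and by \<open>y\<close>.\<close>

lemma trans_bisim:
  assumes "has_4 l"
    and der: "\<And>w z. w = x \<or> sees l \<phi> x w \<Longrightarrow> sees l \<phi> w z \<Longrightarrow>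
      derivable l (Imp (th (ty l (sub_bar \<phi>) w)) (Dia (th (ty l (sub_bar \<phi>) z))))"
  shows "h \<in> lang (vars \<phi>) \<Longrightarrow> u = x \<or> sees l \<phi> x u \<Longrightarrow>
    ty l (sub_bar \<phi>) u = ty l (sub_bar \<phi>) v \<Longrightarrow> csat l u h \<longleftrightarrow> csat l v h"
proof -
  let ?t = "ty l (sub_bar \<phi>)"
  have R_sees: "sees l \<phi> u u'" if "cR l u u'" for u u'
    using that trans_cR[OF assms(1) that] by (simp add: sees_def ty_def)
  have region: "sees l \<phi> x u'" if u: "u = x \<or> sees l \<phi> x u" "cR l u u'" for u u'
  proof (cases "u = x")
    case True
    then show ?thesis using R_sees u(2) by simp
  next
    case False
    then show ?thesis using u trans_cR[OF assms(1) u(2)] by (simp add: sees_def)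
  qed
  \<comment> \<open>A derivable diamond depends on the type alone, so it can be used at
    \<open>v\<close> instead of \<open>u\<close>.\<close>
  have step: "\<exists>v'. cR l v v' \<and> ?t v' = ?t z"
    if d: "derivable l (Imp (th (?t u)) (Dia (th (?t z))))" and e: "?t u = ?t v" for u v z
  proof -
    have "csat l v (th (?t u))" unfolding e by (simp add: ty_def)
    then have "csat l v (Dia (th (?t z)))" using d unfolding derivable_iff sat_Imp by blast
    then obtain v' where "cR l v v'" "\<forall>f\<in>?t z. csat l v' f" by auto
    moreover from this have "?t v' = ?t z" by (intro ty_eqI neg_sub_bar)
    ultimately show ?thesis by blast
  qed
  have zig: "\<exists>v'. cR l v v' \<and> ?t u' = ?t v'"
    if "u = x \<or> sees l \<phi> x u" "?t u = ?t v" "cR l u u'" for u v u'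
    using step[OF der[OF that(1) R_sees[OF that(3)]] that(2)] by metis
  \<comment> \<open>\<open>v'\<close> need not be a successor of \<open>u\<close>, but
    \<open>u\<close> sees it because \<open>u\<close> and \<open>v\<close> have the same boxes in
    \<open>sub_bar \<phi>\<close>. This is why \<open>der\<close> refers to \<open>sees\<close>
    instead of \<open>cR\<close>.\<close>
  have zag: "\<exists>u'. cR l u u' \<and> ?t u' = ?t v'"
    if "u = x \<or> sees l \<phi> x u" "?t u = ?t v" "cR l v v'" for u v v'
  proof -
    have "sees l \<phi> u v'" using R_sees[OF that(3)] that(2) by (simp add: sees_def)
    from step[OF der[OF that(1) this] refl] show ?thesis .
  qed
  show "h \<in> lang (vars \<phi>) \<Longrightarrow> u = x \<or> sees l \<phi> x u \<Longrightarrow> ?t u = ?t v \<Longrightarrow>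
    csat l u h \<longleftrightarrow> csat l v h"
  proof (induction h arbitrary: u v)
    case (Pos p)
    then have "Pos p \<in> sub_bar \<phi>" using sub_bar_var by (simp add: lang_def)
    then show ?case by (rule ty_eqD[OF Pos.prems(3)])
  next
    case (Neg p)
    then have "Neg p \<in> sub_bar \<phi>" using sub_bar_var by (simp add: lang_def)
    then show ?case by (rule ty_eqD[OF Neg.prems(3)])
  next
    case (Box h)
    then have "h \<in> lang (vars \<phi>)" by (simp add: lang_def)
    then have IH: "csat l u' h \<longleftrightarrow> csat l v' h" if "cR l u u'" "?t u' = ?t v'" for u' v'
      using Box.IH[of u' v'] region[OF Box.prems(2) that(1)] that(2) by blast
    show ?case
      using zig[OF Box.prems(2,3)] zag[OF Box.prems(2,3)] IH unfolding sat.simps by metis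
  next
    case (Dia h)
    then have "h \<in> lang (vars \<phi>)" by (simp add: lang_def)
    then have IH: "csat l u' h \<longleftrightarrow> csat l v' h" if "cR l u u'" "?t u' = ?t v'" for u' v'
      using Dia.IH[of u' v'] region[OF Dia.prems(2) that(1)] that(2) by blast
    show ?case
      using zig[OF Dia.prems(2,3)] zag[OF Dia.prems(2,3)] IH unfolding sat.simps by metis
  next
    case (And f g)
    then have "f \<in> lang (vars \<phi>)" "g \<in> lang (vars \<phi>)" by (simp_all add: lang_def)
    then show ?case using And.IH[OF _ And.prems(2,3)] by simp
  next
    case (Or f g)
    then have "f \<in> lang (vars \<phi>)" "g \<in> lang (vars \<phi>)" by (simp_all add: lang_def)
    then show ?case using Or.IH[OF _ Or.prems(2,3)] by simp
  qed auto
qed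

text \<open>By contraposition of \<open>trans_bisim\<close> some diamond is not derivable, at
  \<open>x\<close> or at a point seen from \<open>x\<close>. One move reaches it, so
  \<open>N > 0\<close> is enough.\<close>

lemma trans_loop_complete:
  assumes "has_4 l" "ty l (sub_bar \<phi>) x = ty l (sub_bar \<phi>) y" "h \<in> lang (vars \<phi>)"
    "csat l x h \<noteq> csat l y h" "N > 0"
  shows "cc_loop l \<phi> (ty l (sub_bar \<phi>) x) N Accept"
proof -
  let ?t = "ty l (sub_bar \<phi>)"
  have accept: "cc_loop l \<phi> (?t w) n Accept"
    if z: "sees l \<phi> w z" "\<not> derivable l (Imp (th (?t w)) (Dia (th (?t z))))" for w z n
  proof -
    obtain S where "cc_construct l \<phi> (?t w) S" "?t z \<in> children S"
      using trans_construct[OF assms(1) z(1)] by blast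
    then show ?thesis
      using z(2) by (intro cc_loop.cond_accept) (auto simp: cc_accept_cond_def)
  qed
  obtain w z where w: "w = x \<or> sees l \<phi> x w" and z: "sees l \<phi> w z"
    "\<not> derivable l (Imp (th (?t w)) (Dia (th (?t z))))"
    using trans_bisim[OF assms(1) _ assms(3), of x x y] assms(2,4) by blast
  from w show ?thesis
  proof
    assume "w = x"
    then show ?thesis using accept z by blast
  next
    assume "sees l \<phi> x w"
    then obtain S where S: "cc_construct l \<phi> (?t x) S" "?t w \<in> children S"
      using trans_construct[OF assms(1)] by blast
    show ?thesis
    proof (cases "cc_accept_cond l (?t x) S")
      case True
      then show ?thesis using S by (intro cc_loop.cond_accept) auto
    next
      case False
      then show ?thesis
        using S assms(5) accept[OF z] by (intro cc_loop.next_continue[OF S(1) _ False S(2)]) auto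
    qed
  qed
qed

section \<open>The two directions for all four logics\<close>

theorem theorem19:
  fixes l :: logic and \<phi> :: fm
  shows "cc_accepts l \<phi> \<longleftrightarrow> incomplete l \<phi>"
proof
  have l: "l = K \<or> has_4 l" by (cases l) (auto simp: has_4_def)
  assume "cc_accepts l \<phi>"
  then have "cc_run l \<phi> Accept" by (simp add: cc_accepts_def)
  then show "incomplete l \<phi>"
  proof cases
    case (init_accept a b)
    obtain x y where a: "a = ty l (sub_bar \<phi>) x" and b: "b = ty l (sub_bar \<phi>) y"
      using init_accept maximal_iff by metis
    obtain g where "g \<in> sub_bar \<phi>" "csat l x g \<noteq> csat l y g"
      using init_accept(5) by (auto simp: a b ty_def)
    moreover from this have "g \<in> lang (vars \<phi>)" using sub_bar_vars by (auto simp: lang_def)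
    moreover have "csat l x \<phi>" "csat l y \<phi>" using init_accept by (auto simp: a b ty_def)
    ultimately show ?thesis using incompleteI by metis
  next
    case (init_loop a b)
    from l obtain g x y where "g \<in> lang (vars \<phi>)" "\<forall>f\<in>a. csat l x f" "csat l x g"
      "\<forall>f\<in>a. csat l y f" "\<not> csat l y g"
    proof
      assume "l = K"
      then show ?thesis using that K_loop_incomplete[OF init_loop(6)] by blast
    next
      assume "has_4 l"
      then show ?thesis using that trans_loop_incomplete[OF init_loop(6)] init_loop(1) by blast
    qed
    then show ?thesis using init_loop(2) by (intro incompleteI[of g \<phi> l x y]) auto
  qed
next
  let ?t = "ty l (sub_bar \<phi>)"
  assume "incomplete l \<phi>"
  then obtain g x y where g: "g \<in> lang (vars \<phi>)" "csat l x \<phi>" "csat l y \<phi>"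
    "csat l x g \<noteq> csat l y g"
    by (auto simp: incomplete_def complete_def derivable_iff)
  have in_ty: "\<phi> \<in> ?t x" "\<phi> \<in> ?t y" using g by (auto simp: ty_def sub_bar_def)
  have max: "maximal l \<phi> (?t x)" "maximal l \<phi> (?t y)" by (auto simp: maximal_iff)
  show "cc_accepts l \<phi>"
    unfolding cc_accepts_def
  proof (cases "?t x = ?t y")
    case True
    have "cc_loop l \<phi> (?t x) (fsize \<phi> + 2) Accept"
    proof (cases "l = K")
      case K: True
      have "md \<phi> \<le> fsize \<phi> + 2" using md_less_fsize[of \<phi>] by simp
      from K_loop_accept[OF _ g(1) _ this, of x y] show ?thesis
        using True g(4) K by (simp add: sub_bar_upto_md)
    next
      case False
      then have "has_4 l" by (cases l) (auto simp: has_4_def)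
      then show ?thesis using trans_loop_complete[OF _ True g(1,4)] by simp
    qed
    then show "cc_run l \<phi> Accept"
      using cc_run.init_loop[OF max(1) in_ty(1) max(1) in_ty(1)] by simp
  next
    case False
    then show "cc_run l \<phi> Accept" using cc_run.init_accept[OF max(1) in_ty(1) max(2) in_ty(2)] by simp
  qed
qed

end
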